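(* When $\mathcal{P}$ is $1|prec|\max w_jT_j$, the problems $\textsc{Min-Exp}~\mathcal{P}$, $\textsc{Min-VaR}_\alpha~\mathcal{P}$ and $\textsc{Min-CVaR}_\alpha~\mathcal{P}$ are solvable in $O(f_{\max}^K\,(Kn^2))$ time.
   Context: Single machine scheduling: a set $J$ of $n$ jobs with precedence constraints; a schedule $\pi$ is a permutation of $J$ respecting them, processed without idle time from time 0. Each job has a deterministic positive integer weight $w_j$. A scenario set $\mathcal{U}=\{\xi_1,\dots,\xi_K\}$ with probabilities ${\rm Pr}[\xi_i]>0$ summing to 1 specifies nonnegative integer processing times $p_j(\xi)$ and nonnegative integer due dates $d_j(\xi)$. $C_j(\pi,\xi)$ is the completion time of $j$ under $\xi$, $T_j(\pi,\xi)=\max\{0,C_j(\pi,\xi)-d_j(\xi)\}$ and $f(\pi,\xi)=\max_jw_jT_j(\pi,\xi)$. $f_{\max}$ is an upper bound on $f(\pi,\xi)$ over all schedules and scenarios. ${\rm F}(\pi)$ is the random variable equal to $f(\pi,\xi_i)$ with probability ${\rm Pr}[\xi_i]$. $\textsc{Min-Exp}$ minimizes $\mathbf{E}[{\rm F}(\pi)]$; $\textsc{Min-VaR}_\alpha$ ($\alpha\in(0,1]$) minimizes $\mathbf{VaR}_\alpha[{\rm F}(\pi)]=\inf\{t:{\rm Pr}[{\rm F}(\pi)\le t]\ge\alpha\}$; $\textsc{Min-CVaR}_\alpha$ ($\alpha\in[0,1)$) minimizes $\mathbf{CVaR}_\alpha[{\rm F}(\pi)]=\inf_{\gamma}\{\gamma+\frac{1}{1-\alpha}\mathbf{E}[({\rm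 F}(\pi)-\gamma)^+]\}$.
   Formalization: The bound is proved with a constant depending on K when f_max ≥ 1, and with an absolute constant when f_max^K is replaced by (f_max+1)^K; the printed bound is 0 for f_max = 0, and a K-independent constant at f_max = 1 would solve an NP-hard problem in O(Kn²) time. *)

theory Defs
  imports "HOL-Probability.Probability" "HOL-Combinatorics.Multiset_Permutations"
begin

section \<open>Scheduling under a discrete scenario set\<close>

text \<open>
  The jobs are \<open>0, \<dots>, njobs - 1\<close> and the scenarios \<open>0, \<dots>, nscens - 1\<close>.
  \<open>(i, j) \<in> prec\<close> means that job \<open>i\<close> must precede job \<open>j\<close>; \<open>ptime \<xi> j\<close> and \<open>due \<xi> j\<close> are
  the processing time and the due date of \<open>j\<close> under \<open>\<xi>\<close>.
\<close>

record sched_instance =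
  njobs :: nat
  nscens :: nat
  prec :: "(nat \<times> nat) set"
  weight :: "nat \<Rightarrow> nat"
  ptime :: "nat \<Rightarrow> nat \<Rightarrow> nat"
  due :: "nat \<Rightarrow> nat \<Rightarrow> nat"
  scen_pmf :: "nat pmf"

text \<open>Arbitrary acyclic arc sets are allowed; \<open>prec\<close> need not be transitively closed.\<close>

definition valid_instance :: "sched_instance \<Rightarrow> bool" where
  "valid_instance I \<longleftrightarrow>
     njobs I \<ge> 1 \<and>
     prec I \<subseteq> {..<njobs I} \<times> {..<njobs I} \<and> acyclic (prec I) \<and>
     (\<forall>j<njobs I. weight I j > 0) \<and>
     set_pmf (scen_pmf I) = {..<nscens I}"

definition schedule :: "sched_instance \<Rightarrow> nat list \<Rightarrow> bool" where
  "schedule I \<pi> \<longleftrightarrow>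
     \<pi> \<in> permutations_of_set {..<njobs I} \<and>
     (\<forall>a<njobs I. \<forall>b<njobs I. (\<pi> ! a, \<pi> ! b) \<in> prec I \<longrightarrow> a < b)"

definition completion :: "sched_instance \<Rightarrow> nat list \<Rightarrow> nat \<Rightarrow> nat \<Rightarrow> nat" where
  "completion I \<pi> \<xi> j = sum_list (map (ptime I \<xi>) (takeWhile (\<lambda>i. i \<noteq> j) \<pi>)) + ptime I \<xi> j"

definition tardiness :: "sched_instance \<Rightarrow> nat list \<Rightarrow> nat \<Rightarrow> nat \<Rightarrow> int" where
  "tardiness I \<pi> \<xi> j = max 0 (int (completion I \<pi> \<xi> j) - int (due I \<xi> j))"

definition max_weighted_tardiness :: "sched_instance \<Rightarrow> nat list \<Rightarrow> nat \<Rightarrow> int" where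
  "max_weighted_tardiness I \<pi> \<xi> = (MAX j\<in>{..<njobs I}. int (weight I j) * tardiness I \<pi> \<xi> j)"

definition cost_bound :: "sched_instance \<Rightarrow> nat \<Rightarrow> bool" where
  "cost_bound I fmax \<longleftrightarrow>
     (\<forall>\<pi> \<xi>. schedule I \<pi> \<longrightarrow> \<xi> < nscens I \<longrightarrow> max_weighted_tardiness I \<pi> \<xi> \<le> int fmax)"

definition cost_pmf :: "sched_instance \<Rightarrow> nat list \<Rightarrow> real pmf" where
  "cost_pmf I \<pi> = map_pmf (\<lambda>\<xi>. real_of_int (max_weighted_tardiness I \<pi> \<xi>)) (scen_pmf I)"

definition Exp_cost :: "sched_instance \<Rightarrow> nat list \<Rightarrow> real" where
  "Exp_cost I \<pi> = measure_pmf.expectation (cost_pmf I \<pi>) (\<lambda>x. x)"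

definition VaR_cost :: "real \<Rightarrow> sched_instance \<Rightarrow> nat list \<Rightarrow> real" where
  "VaR_cost \<alpha> I \<pi> = Inf {t. measure_pmf.prob (cost_pmf I \<pi>) {..t} \<ge> \<alpha>}"

definition CVaR_cost :: "real \<Rightarrow> sched_instance \<Rightarrow> nat list \<Rightarrow> real" where
  "CVaR_cost \<alpha> I \<pi> =
     (INF \<gamma>. \<gamma> + 1 / (1 - \<alpha>) * measure_pmf.expectation (cost_pmf I \<pi>) (\<lambda>x. max 0 (x - \<gamma>)))"


section \<open>A unit-cost random access machine\<close>

text \<open>
  A structured real RAM: a store consists of registers and an addressable memory, both holding
  real numbers.  Every arithmetic operation, memory access and comparison costs one step.  There
  is neither division nor rounding, program constants are natural numbers, and a memory access
  whose address is not a natural number gets stuck.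
\<close>

datatype ram =
    Skip
  | Const nat nat
  | Add nat nat nat
  | Sub nat nat nat
  | Mul nat nat nat
  | Load nat nat
  | Store nat nat
  | Seq ram ram
  | IfLe nat nat ram ram
  | WhileLe nat nat ram

type_synonym store = "(nat \<Rightarrow> real) \<times> (nat \<Rightarrow> real)"

text \<open>\<open>exec P s t s'\<close>: started in store \<open>s\<close>, program \<open>P\<close> halts in store \<open>s'\<close> after exactly \<open>t\<close> steps.\<close>

inductive exec :: "ram \<Rightarrow> store \<Rightarrow> nat \<Rightarrow> store \<Rightarrow> bool" where
  Skip: "exec Skip s 1 s"
| Const: "exec (Const r c) (R, M) 1 (R(r := real c), M)"
| Add: "exec (Add r a b) (R, M) 1 (R(r := R a + R b), M)"
| Sub: "exec (Sub r a b) (R, M) 1 (R(r := R a - R b), M)"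
| Mul: "exec (Mul r a b) (R, M) 1 (R(r := R a * R b), M)"
| Load: "R a = real k \<Longrightarrow> exec (Load r a) (R, M) 1 (R(r := M k), M)"
| Store: "R a = real k \<Longrightarrow> exec (Store a b) (R, M) 1 (R, M(k := R b))"
| Seq: "exec P s t s' \<Longrightarrow> exec Q s' t' s'' \<Longrightarrow> exec (Seq P Q) s (t + t') s''"
| IfTrue: "fst s a \<le> fst s b \<Longrightarrow> exec P s t s' \<Longrightarrow> exec (IfLe a b P Q) s (Suc t) s'"
| IfFalse: "\<not> fst s a \<le> fst s b \<Longrightarrow> exec Q s t s' \<Longrightarrow> exec (IfLe a b P Q) s (Suc t) s'"
| WhileFalse: "\<not> fst s a \<le> fst s b \<Longrightarrow> exec (WhileLe a b P) s 1 s"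
| WhileTrue: "fst s a \<le> fst s b \<Longrightarrow> exec P s t s' \<Longrightarrow> exec (WhileLe a b P) s' t' s'' \<Longrightarrow>
    exec (WhileLe a b P) s (Suc (t + t')) s''"

lemma exec_deterministic:
  "exec P s t s' \<Longrightarrow> exec P s u s'' \<Longrightarrow> u = t \<and> s'' = s'"
proof (induction arbitrary: u s'' rule: exec.induct)
  case (Seq P s t s' Q t' s'')
  from Seq.prems show ?case by cases (use Seq.IH in blast)
next
  case (IfTrue s a b P t s' Q)
  from IfTrue.prems show ?case by cases (use IfTrue in blast)+
next
  case (IfFalse s a b Q t s' P)
  from IfFalse.prems show ?case by cases (use IfFalse in blast)+
next
  case (WhileTrue s a b P t s' t' s'')
  from WhileTrue.prems show ?case by cases (use WhileTrue in blast)+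
qed (erule exec.cases; simp)+


section \<open>Solvability in bounded time\<close>

text \<open>
  Input format: the parameters of the objective, the numbers of jobs and scenarios, the cost
  bound, the weights, the processing times and the due dates (both scenario by scenario), the
  scenario probabilities, and the adjacency matrix of the precedence relation.
\<close>

definition encode :: "real list \<Rightarrow> sched_instance \<Rightarrow> nat \<Rightarrow> real list" where
  "encode par I fmax =
     (let n = njobs I; K = nscens I in
        par @ [real n, real K, real fmax]
        @ map (\<lambda>j. real (weight I j)) [0..<n]
        @ concat (map (\<lambda>\<xi>. map (\<lambda>j. real (ptime I \<xi> j)) [0..<n]) [0..<K])
        @ concat (map (\<lambda>\<xi>. map (\<lambda>j. real (due I \<xi> j)) [0..<n]) [0..<K])
        @ map (\<lambda>\<xi>. pmf (scen_pmf I) \<xi>) [0..<K]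
        @ concat (map (\<lambda>i. map (\<lambda>j. if (i, j) \<in> prec I then 1 else 0) [0..<n]) [0..<n]))"

definition init_store :: "real list \<Rightarrow> store" where
  "init_store xs = (\<lambda>_. 0, \<lambda>a. if a < length xs then xs ! a else 0)"

text \<open>The program has to leave an optimal schedule in the first memory cells.\<close>

definition solves_within ::
  "(sched_instance \<Rightarrow> nat list \<Rightarrow> real) \<Rightarrow> real list \<Rightarrow> ram \<Rightarrow> sched_instance \<Rightarrow> nat \<Rightarrow> real \<Rightarrow> bool"
where
  "solves_within obj par P I fmax B \<longleftrightarrow>
     (\<exists>t R M \<pi>. exec P (init_store (encode par I fmax)) t (R, M) \<and> real t \<le> B \<and>
        is_arg_min (obj I) (schedule I) \<pi> \<and> (\<forall>k<njobs I. M k = real (\<pi> ! k)))"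

text \<open>
  The costs range over the \<open>fmax + 1\<close> values \<open>0, \<dots>, fmax\<close>, and \<open>(fmax + 1) ^ K\<close> is
  \<open>O(fmax ^ K)\<close> only for \<open>fmax \<ge> 1\<close> and with a constant that depends on \<open>K\<close>.  (A constant
  independent of \<open>K\<close> would, for \<open>fmax = 1\<close>, give a polynomial algorithm for minimum feedback
  arc set: take one scenario per arc \<open>(i, j)\<close>, with \<open>ptime j = 1\<close>, \<open>due i = 0\<close>, all other
  processing times \<open>0\<close> and all other due dates \<open>1\<close>.)  Hence the bound \<open>T n K fmax\<close> is required of
  one program with a constant for each \<open>K\<close> and, in addition, with a single constant for all
  inputs once \<open>fmax\<close> is replaced by the number of cost values.
\<close>

definition solvable_in_O ::
  "(sched_instance \<Rightarrow> nat list \<Rightarrow> real) \<Rightarrow> real list \<Rightarrow> (nat \<Rightarrow> nat \<Rightarrow> nat \<Rightarrow> real) \<Rightarrow> bool"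
where
  "solvable_in_O obj par T \<longleftrightarrow>
     (\<exists>P.
        (\<forall>K. \<exists>c. \<forall>I fmax. valid_instance I \<and> nscens I = K \<and> cost_bound I fmax \<and> fmax \<ge> 1 \<longrightarrow>
           solves_within obj par P I fmax (c * T (njobs I) K fmax)) \<and>
        (\<exists>c. \<forall>I fmax. valid_instance I \<and> cost_bound I fmax \<longrightarrow>
           solves_within obj par P I fmax (c * T (njobs I) (nscens I) (fmax + 1))))"

end

theory Submission
  imports Defs
begin

text \<open>
  An optimal schedule is found by enumerating threshold vectors \<open>t \<in> {0..fmax}^K\<close>.  For a fixed
  \<open>t\<close>, Lawler's rule decides in \<open>O(K n\<^sup>2)\<close> steps whether some schedule has cost at most \<open>t i\<close> in
  every scenario \<open>i\<close>: fill the positions from the last to the first, each time with any job that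
  has no unscheduled successor and tolerates completion at the total processing time of the
  unscheduled jobs.  If no such job exists for the unscheduled set \<open>V\<close>, then in every schedule the
  job of \<open>V\<close> that comes last violates \<open>t\<close>.

  A vector must be evaluated in \<open>O(K)\<close> steps, so quantiles cannot be computed by sorting.  Instead
  the minimum of \<open>t\<close> takes the role of the quantile: raising every threshold below \<open>\<gamma>\<close> to \<open>\<gamma>\<close> only
  weakens the constraints, so \<open>(1 - \<alpha>) CVaR\<close> is the least value of \<open>\<Sum> q i * t i - \<alpha> * min t\<close>
  over the attainable \<open>t\<close> (the expectation is the case \<open>\<alpha> = 0\<close>), and VaR is the least \<open>min t\<close> over
  the attainable \<open>t\<close> that take their minimum with probability at least \<open>\<alpha>\<close>.
\<close>

section \<open>Value at risk of bounded natural-valued distributions\<close>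

definition rockafellar :: "real \<Rightarrow> real pmf \<Rightarrow> real \<Rightarrow> real" where
  "rockafellar \<alpha> \<mu> \<gamma> =
     \<gamma> + 1 / (1 - \<alpha>) * measure_pmf.expectation \<mu> (\<lambda>x. max 0 (x - \<gamma>))"

lemma rockafellar_scaled:
  assumes "finite (set_pmf \<mu>)" "\<alpha> < 1"
  shows "(1 - \<alpha>) * rockafellar \<alpha> \<mu> \<gamma> = measure_pmf.expectation \<mu> (\<lambda>x. max x \<gamma>) - \<alpha> * \<gamma>"
proof -
  have int: "integrable (measure_pmf \<mu>) f" for f :: "real \<Rightarrow> real"
    by (rule integrable_measure_pmf_finite) fact
  have "measure_pmf.expectation \<mu> (\<lambda>x. max 0 (x - \<gamma>)) = measure_pmf.expectation \<mu> (\<lambda>x. max x \<gamma> - \<gamma>)"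
    by (rule Bochner_Integration.integral_cong) (auto simp: max_def)
  also have "\<dots> = measure_pmf.expectation \<mu> (\<lambda>x. max x \<gamma>) - \<gamma>" by (simp add: int)
  finally have excess: "measure_pmf.expectation \<mu> (\<lambda>x. max 0 (x - \<gamma>)) =
      measure_pmf.expectation \<mu> (\<lambda>x. max x \<gamma>) - \<gamma>" .
  show ?thesis unfolding rockafellar_def excess using assms(2) by (simp add: field_simps)
qed

locale bounded_nat_pmf =
  fixes \<mu> :: "real pmf" and m :: nat
  assumes support: "set_pmf \<mu> \<subseteq> real ` {..m}"
begin

lemma finite_support: "finite (set_pmf \<mu>)"
  using support by (rule finite_subset) simp

lemma integrable: "integrable (measure_pmf \<mu>) (f :: real \<Rightarrow> real)"
  by (rule integrable_measure_pmf_finite[OF finite_support])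

lemma AE_nat: "AE x in \<mu>. \<exists>k\<le>m. x = real k"
  using support by (auto intro!: AE_pmfI)

lemma rockafellar_affine:
  assumes "0 \<le> \<theta>" "\<theta> \<le> 1"
  shows "rockafellar \<alpha> \<mu> (real k + \<theta>) =
    (1 - \<theta>) * rockafellar \<alpha> \<mu> (real k) + \<theta> * rockafellar \<alpha> \<mu> (real (Suc k))"
proof -
  let ?e = "\<lambda>\<gamma>. measure_pmf.expectation \<mu> (\<lambda>x. max 0 (x - \<gamma>))"
  have affine: "max 0 (real c - (real k + \<theta>)) =
      (1 - \<theta>) * max 0 (real c - real k) + \<theta> * max 0 (real c - real (Suc k))" for c
  proof (cases "c \<le> k")
    case False
    then have "real k + 1 \<le> real c" by linarith
    then show ?thesis using assms by (simp add: max_def algebra_simps)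
  qed (use assms in simp)
  have "?e (real k + \<theta>) = measure_pmf.expectation \<mu>
      (\<lambda>x. (1 - \<theta>) * max 0 (x - real k) + \<theta> * max 0 (x - real (Suc k)))"
  proof (rule integral_cong_AE)
    show "AE x in \<mu>. max 0 (x - (real k + \<theta>)) =
        (1 - \<theta>) * max 0 (x - real k) + \<theta> * max 0 (x - real (Suc k))"
      using AE_nat affine by fastforce
  qed simp_all
  also have "\<dots> = (1 - \<theta>) * ?e (real k) + \<theta> * ?e (real (Suc k))"
    by (simp add: integrable)
  finally have excess: "?e (real k + \<theta>) = (1 - \<theta>) * ?e (real k) + \<theta> * ?e (real (Suc k))" .
  show ?thesis unfolding rockafellar_def excess
    by (simp add: algebra_simps add_divide_distrib diff_divide_distrib)
qed

lemma rockafellar_mono_above: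
  assumes "\<alpha> < 1" "real m \<le> \<gamma>"
  shows "rockafellar \<alpha> \<mu> (real m) \<le> rockafellar \<alpha> \<mu> \<gamma>"
proof -
  have "rockafellar \<alpha> \<mu> x = x" if "real m \<le> x" for x
  proof -
    have "measure_pmf.expectation \<mu> (\<lambda>y. max 0 (y - x)) = measure_pmf.expectation \<mu> (\<lambda>_. 0)"
      by (rule integral_cong_AE) (use AE_nat that in \<open>auto elim!: eventually_mono\<close>)
    then show ?thesis by (simp add: rockafellar_def)
  qed
  then show ?thesis using assms by simp
qed

lemma rockafellar_antimono_below:
  assumes "0 \<le> \<alpha>" "\<alpha> < 1" "\<gamma> \<le> 0"
  shows "rockafellar \<alpha> \<mu> 0 \<le> rockafellar \<alpha> \<mu> \<gamma>"
proof -
  have "measure_pmf.expectation \<mu> (\<lambda>x. max x 0) = measure_pmf.expectation \<mu> (\<lambda>x. max x \<gamma>)"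
    by (rule integral_cong_AE) (use AE_nat assms(3) in \<open>auto elim!: eventually_mono\<close>)
  moreover have "\<alpha> * \<gamma> \<le> 0" using assms by (simp add: mult_nonneg_nonpos)
  ultimately have "(1 - \<alpha>) * rockafellar \<alpha> \<mu> 0 \<le> (1 - \<alpha>) * rockafellar \<alpha> \<mu> \<gamma>"
    by (simp add: rockafellar_scaled finite_support assms)
  then show ?thesis using assms(2) by simp
qed

lemma rockafellar_ge_nat:
  assumes "0 \<le> \<alpha>" "\<alpha> < 1"
  shows "\<exists>k\<le>m. rockafellar \<alpha> \<mu> (real k) \<le> rockafellar \<alpha> \<mu> \<gamma>"
proof -
  consider (below) "\<gamma> \<le> 0" | (above) "real m \<le> \<gamma>" | (between) "0 < \<gamma>" "\<gamma> < real m" by linarith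
  then show ?thesis
  proof cases
    case below
    then show ?thesis using rockafellar_antimono_below[OF assms] by (intro exI[of _ 0]) simp
  next
    case above
    then show ?thesis using rockafellar_mono_above[OF assms(2)] by blast
  next
    case between
    define k where "k = nat \<lfloor>\<gamma>\<rfloor>"
    define \<theta> where "\<theta> = \<gamma> - real k"
    have \<theta>: "0 \<le> \<theta>" "\<theta> \<le> 1" using between(1) unfolding \<theta>_def k_def by linarith+
    have "Suc k \<le> m" using between unfolding k_def by linarith
    let ?a = "rockafellar \<alpha> \<mu> (real k)" and ?b = "rockafellar \<alpha> \<mu> (real (Suc k))"
    have "min ?a ?b = (1 - \<theta>) * min ?a ?b + \<theta> * min ?a ?b" by (simp add: algebra_simps)
    also have "\<dots> \<le> (1 - \<theta>) * ?a + \<theta> * ?b" using \<theta> by (intro add_mono mult_left_mono) auto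
    also have "\<dots> = rockafellar \<alpha> \<mu> \<gamma>" using rockafellar_affine[OF \<theta>, of \<alpha> k] by (simp add: \<theta>_def)
    finally have "?a \<le> rockafellar \<alpha> \<mu> \<gamma> \<or> ?b \<le> rockafellar \<alpha> \<mu> \<gamma>" by linarith
    then show ?thesis using \<open>Suc k \<le> m\<close> by (meson Suc_leD)
  qed
qed

lemma rockafellar_minimum_at_nat:
  assumes "0 \<le> \<alpha>" "\<alpha> < 1"
  obtains k where "k \<le> m" "(INF \<gamma>. rockafellar \<alpha> \<mu> \<gamma>) = rockafellar \<alpha> \<mu> (real k)"
    "\<And>\<gamma>. rockafellar \<alpha> \<mu> (real k) \<le> rockafellar \<alpha> \<mu> \<gamma>"
proof -
  let ?r = "\<lambda>k. rockafellar \<alpha> \<mu> (real k)"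
  define k where "k = arg_min_on ?r {..m}"
  have k: "k \<le> m" "\<And>l. l \<le> m \<Longrightarrow> ?r k \<le> ?r l"
    using arg_min_if_finite[of "{..m}" ?r] arg_min_least[of "{..m}" _ ?r] by (auto simp: k_def)
  have least: "?r k \<le> rockafellar \<alpha> \<mu> \<gamma>" for \<gamma>
    using rockafellar_ge_nat[OF assms] k(2) by (meson order_trans)
  then have "(INF \<gamma>. rockafellar \<alpha> \<mu> \<gamma>) = ?r k" by (intro cInf_eq_minimum) auto
  then show thesis using that k(1) least by blast
qed

lemma expectation_eq_rockafellar_0: "rockafellar 0 \<mu> 0 = measure_pmf.expectation \<mu> (\<lambda>x. x)"
proof -
  have "measure_pmf.expectation \<mu> (\<lambda>x. max x 0) = measure_pmf.expectation \<mu> (\<lambda>x. x)"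
    by (rule integral_cong_AE) (use AE_nat in \<open>auto elim!: eventually_mono\<close>)
  then show ?thesis using rockafellar_scaled[OF finite_support, of 0 0] by simp
qed

lemma expectation_eq_INF_rockafellar:
  "measure_pmf.expectation \<mu> (\<lambda>x. x) = (INF \<gamma>. rockafellar 0 \<mu> \<gamma>)"
proof (rule sym, rule cInf_eq_minimum)
  show "measure_pmf.expectation \<mu> (\<lambda>x. x) \<in> range (rockafellar 0 \<mu>)"
    using expectation_eq_rockafellar_0 by (metis rangeI)
  fix y assume "y \<in> range (rockafellar 0 \<mu>)"
  then obtain \<gamma> where "y = measure_pmf.expectation \<mu> (\<lambda>x. max x \<gamma>)"
    using rockafellar_scaled[OF finite_support, of 0] by auto
  then show "measure_pmf.expectation \<mu> (\<lambda>x. x) \<le> y"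
    by (auto intro!: integral_mono integrable)
qed

lemma quantile_at_nat:
  assumes "0 < \<alpha>" "\<alpha> \<le> 1"
  obtains k where "k \<le> m" "\<alpha> \<le> measure_pmf.prob \<mu> {..real k}"
    "Inf {x. \<alpha> \<le> measure_pmf.prob \<mu> {..x}} = real k"
    "\<And>x. \<alpha> \<le> measure_pmf.prob \<mu> {..x} \<Longrightarrow> real k \<le> x"
proof -
  let ?P = "\<lambda>k. \<alpha> \<le> measure_pmf.prob \<mu> {..real k}"
  define k where "k = (LEAST k. ?P k)"
  have "measure_pmf.prob \<mu> {..real m} = 1"
    using support by (subst measure_pmf.prob_eq_1) (auto simp: AE_measure_pmf_iff)
  then have "?P m" using assms(2) by simp
  then have k: "k \<le> m" "?P k" unfolding k_def by (rule Least_le, rule LeastI)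
  have least: "real k \<le> x" if x: "\<alpha> \<le> measure_pmf.prob \<mu> {..x}" for x
  proof -
    have "0 < measure_pmf.prob \<mu> {..x}" using x assms(1) by simp
    then have "set_pmf \<mu> \<inter> {..x} \<noteq> {}" by (metis less_irrefl measure_pmf_zero_iff)
    then have "0 \<le> x" using support by fastforce
    then have "real j \<le> x \<longleftrightarrow> real j \<le> real (nat \<lfloor>x\<rfloor>)" for j
      by (meson le_nat_floor of_nat_floor of_nat_le_iff order_trans)
    then have "set_pmf \<mu> \<inter> {..x} = set_pmf \<mu> \<inter> {..real (nat \<lfloor>x\<rfloor>)}"
      using support by fast
    then have "?P (nat \<lfloor>x\<rfloor>)" using x by (metis measure_Int_set_pmf Int_commute)
    then have "k \<le> nat \<lfloor>x\<rfloor>" unfolding k_def by (rule Least_le)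
    then show ?thesis using \<open>0 \<le> x\<close> by linarith
  qed
  have "Inf {x. \<alpha> \<le> measure_pmf.prob \<mu> {..x}} = real k"
    using k(2) least by (intro cInf_eq_minimum) auto
  then show thesis using that k least by blast
qed

end

section \<open>Objectives as functions of threshold vectors\<close>

locale bounded_instance =
  fixes I :: sched_instance and fmax :: nat
  assumes valid: "valid_instance I" and bound: "cost_bound I fmax"
begin

abbreviation "n \<equiv> njobs I"
abbreviation "K \<equiv> nscens I"
abbreviation "q i \<equiv> pmf (scen_pmf I) i"

lemma n_pos: "0 < n"
  using valid by (simp add: valid_instance_def)

lemma set_scen: "set_pmf (scen_pmf I) = {..<K}"
  using valid by (simp add: valid_instance_def)

lemma K_pos: "0 < K"
  using set_pmf_not_empty[of "scen_pmf I"] by (cases K) (auto simp: set_scen)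

lemma sum_q: "(\<Sum>i<K. q i) = 1"
  by (rule sum_pmf_eq_1) (auto simp: set_scen)

definition job_cost :: "nat list \<Rightarrow> nat \<Rightarrow> nat" where
  "job_cost \<pi> i = nat (max_weighted_tardiness I \<pi> i)"

definition meets :: "(nat \<Rightarrow> nat) \<Rightarrow> nat list \<Rightarrow> bool" where
  "meets t \<pi> \<longleftrightarrow> schedule I \<pi> \<and> (\<forall>i<K. job_cost \<pi> i \<le> t i)"

definition vectors :: "(nat \<Rightarrow> nat) set" where
  "vectors = PiE_dflt {..<K} 0 (\<lambda>_. {..fmax})"

definition exact_value ::
  "(sched_instance \<Rightarrow> nat list \<Rightarrow> real) \<Rightarrow> ((nat \<Rightarrow> nat) \<Rightarrow> real) \<Rightarrow> bool"
where
  "exact_value obj val \<longleftrightarrow>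
     (\<exists>\<kappa>>0. (\<forall>t \<pi>. meets t \<pi> \<longrightarrow> \<kappa> * obj I \<pi> \<le> val t) \<and>
       (\<forall>\<pi>. schedule I \<pi> \<longrightarrow> (\<exists>t\<in>vectors. meets t \<pi> \<and> val t \<le> \<kappa> * obj I \<pi>))) \<and>
     (\<forall>t\<in>vectors. val t \<le> real fmax)"

lemma vectors_iff: "t \<in> vectors \<longleftrightarrow> (\<forall>i<K. t i \<le> fmax) \<and> (\<forall>i\<ge>K. t i = 0)"
  by (auto simp: vectors_def PiE_dflt_def not_less)

lemma job_cost_le_iff:
  "job_cost \<pi> i \<le> c \<longleftrightarrow>
     (\<forall>j<n. weight I j * completion I \<pi> i j \<le> c + weight I j * due I i j)"
proof -
  have "int w * max 0 (int x - int d) \<le> int c \<longleftrightarrow> w * x \<le> c + w * d" for w x d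
  proof -
    have "int w * max 0 (int x - int d) = max 0 (int (w * x) - int (w * d))"
      by (simp add: max_mult_distrib_left right_diff_distrib)
    then show ?thesis by (auto simp del: of_nat_mult)
  qed
  then show ?thesis
    unfolding job_cost_def nat_le_iff max_weighted_tardiness_def tardiness_def
    using n_pos by (subst Max_le_iff) auto
qed

lemma of_int_max_weighted_tardiness:
  "real_of_int (max_weighted_tardiness I \<pi> i) = real (job_cost \<pi> i)"
proof -
  have "0 \<le> int (weight I 0) * tardiness I \<pi> i 0" by (simp add: tardiness_def)
  also have "\<dots> \<le> max_weighted_tardiness I \<pi> i"
    unfolding max_weighted_tardiness_def using n_pos by (intro Max_ge) auto
  finally show ?thesis by (simp add: job_cost_def)
qed

lemma job_cost_le: "schedule I \<pi> \<Longrightarrow> i < K \<Longrightarrow> job_cost \<pi> i \<le> fmax"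
  using bound by (auto simp: cost_bound_def job_cost_def nat_le_iff)

lemma cost_pmf_bounded: "schedule I \<pi> \<Longrightarrow> bounded_nat_pmf (cost_pmf I \<pi>) fmax"
  by standard (auto simp: cost_pmf_def set_scen of_int_max_weighted_tardiness job_cost_le)

lemma expectation_cost:
  "measure_pmf.expectation (cost_pmf I \<pi>) g = (\<Sum>i<K. q i * g (real (job_cost \<pi> i)))"
proof -
  have "measure_pmf.expectation (cost_pmf I \<pi>) g =
      measure_pmf.expectation (scen_pmf I) (\<lambda>i. g (real (job_cost \<pi> i)))"
    by (simp add: cost_pmf_def of_int_max_weighted_tardiness)
  also have "\<dots> = (\<Sum>i<K. g (real (job_cost \<pi> i)) * q i)"
    by (rule integral_measure_pmf_real) (auto simp: set_scen)
  finally show ?thesis by (simp add: mult.commute)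
qed

lemma prob_cost:
  "measure_pmf.prob (cost_pmf I \<pi>) {..x} = (\<Sum>i<K. if real (job_cost \<pi> i) \<le> x then q i else 0)"
proof -
  have "measure_pmf.prob (cost_pmf I \<pi>) {..x} =
      measure_pmf.expectation (cost_pmf I \<pi>) (indicator {..x})"
    by simp
  also have "\<dots> = (\<Sum>i<K. if real (job_cost \<pi> i) \<le> x then q i else 0)"
    unfolding expectation_cost by (intro sum.cong) (auto simp: indicator_def)
  finally show ?thesis .
qed

definition minimum :: "(nat \<Rightarrow> nat) \<Rightarrow> nat" where
  "minimum t = Min (t ` {..<K})"

lemma minimum_le: "i < K \<Longrightarrow> minimum t \<le> t i"
  by (auto simp: minimum_def)

lemma minimum_ge_iff: "c \<le> minimum t \<longleftrightarrow> (\<forall>i<K. c \<le> t i)"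
  unfolding minimum_def using K_pos by (subst Min_ge_iff) (auto simp: lessThan_empty_iff)

lemma minimum_le_fmax: "t \<in> vectors \<Longrightarrow> minimum t \<le> fmax"
  using minimum_le[OF K_pos, of t] K_pos by (force simp: vectors_iff)

subsection \<open>Conditional value at risk\<close>

text \<open>The value is scaled by \<open>1 - \<alpha>\<close> because the machine cannot divide.\<close>

definition CVaR_value :: "real \<Rightarrow> (nat \<Rightarrow> nat) \<Rightarrow> real" where
  "CVaR_value \<alpha> t = (\<Sum>i<K. q i * real (t i)) - \<alpha> * real (minimum t)"

lemma CVaR_cost_eq: "CVaR_cost \<alpha> I \<pi> = (INF \<gamma>. rockafellar \<alpha> (cost_pmf I \<pi>) \<gamma>)"
  by (simp add: CVaR_cost_def rockafellar_def)

lemma rockafellar_cost: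
  assumes "schedule I \<pi>" "\<alpha> < 1"
  shows "(1 - \<alpha>) * rockafellar \<alpha> (cost_pmf I \<pi>) \<gamma> =
    (\<Sum>i<K. q i * max (real (job_cost \<pi> i)) \<gamma>) - \<alpha> * \<gamma>"
  using bounded_nat_pmf.finite_support[OF cost_pmf_bounded[OF assms(1)]] assms(2)
  by (simp add: rockafellar_scaled expectation_cost)

lemma CVaR_cost_le_value:
  assumes \<alpha>: "0 \<le> \<alpha>" "\<alpha> < 1" and "meets t \<pi>"
  shows "(1 - \<alpha>) * CVaR_cost \<alpha> I \<pi> \<le> CVaR_value \<alpha> t"
proof -
  have \<pi>: "schedule I \<pi>" using assms(3) by (simp add: meets_def)
  interpret bounded_nat_pmf "cost_pmf I \<pi>" fmax by (rule cost_pmf_bounded[OF \<pi>])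
  let ?r = "rockafellar \<alpha> (cost_pmf I \<pi>) (real (minimum t))"
  have "CVaR_cost \<alpha> I \<pi> \<le> ?r"
    unfolding CVaR_cost_eq using rockafellar_minimum_at_nat[OF \<alpha>] by metis
  then have "(1 - \<alpha>) * CVaR_cost \<alpha> I \<pi> \<le> (1 - \<alpha>) * ?r"
    using \<alpha> by (intro mult_left_mono) auto
  also have "\<dots> \<le> CVaR_value \<alpha> t"
    unfolding rockafellar_cost[OF \<pi> \<alpha>(2)] CVaR_value_def
    using assms(3) minimum_le
    by (intro diff_right_mono sum_mono mult_left_mono) (auto simp: meets_def)
  finally show ?thesis .
qed

lemma CVaR_value_le_cost:
  assumes \<alpha>: "0 \<le> \<alpha>" "\<alpha> < 1" and \<pi>: "schedule I \<pi>"
  shows "\<exists>t\<in>vectors. meets t \<pi> \<and> CVaR_value \<alpha> t \<le> (1 - \<alpha>) * CVaR_cost \<alpha> I \<pi>"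
proof -
  interpret bounded_nat_pmf "cost_pmf I \<pi>" fmax by (rule cost_pmf_bounded[OF \<pi>])
  obtain k where k: "k \<le> fmax" "CVaR_cost \<alpha> I \<pi> = rockafellar \<alpha> (cost_pmf I \<pi>) (real k)"
    unfolding CVaR_cost_eq using rockafellar_minimum_at_nat[OF \<alpha>] by metis
  let ?t = "\<lambda>i. if i < K then max (job_cost \<pi> i) k else 0"
  have "k \<le> minimum ?t" by (simp add: minimum_ge_iff)
  then have "\<alpha> * real k \<le> \<alpha> * real (minimum ?t)" using \<alpha> by (intro mult_left_mono) auto
  then have "CVaR_value \<alpha> ?t \<le> (1 - \<alpha>) * CVaR_cost \<alpha> I \<pi>"
    unfolding k(2) rockafellar_cost[OF \<pi> \<alpha>(2)] CVaR_value_def by (simp add: of_nat_max)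
  moreover have "?t \<in> vectors" "meets ?t \<pi>"
    using job_cost_le[OF \<pi>] k(1) \<pi> by (auto simp: vectors_iff meets_def)
  ultimately show ?thesis by blast
qed

lemma CVaR_value_le:
  assumes "0 \<le> \<alpha>" "t \<in> vectors"
  shows "CVaR_value \<alpha> t \<le> real fmax"
proof -
  have "(\<Sum>i<K. q i * real (t i)) \<le> (\<Sum>i<K. q i * real fmax)"
    using assms(2) by (intro sum_mono mult_left_mono) (auto simp: vectors_iff)
  also have "\<dots> = real fmax" by (simp add: sum_distrib_right[symmetric] sum_q)
  also have "real fmax \<le> real fmax + \<alpha> * real (minimum t)" using assms(1) by simp
  finally show ?thesis by (simp add: CVaR_value_def)
qed

lemma exact_value_CVaR:
  assumes "0 \<le> \<alpha>" "\<alpha> < 1"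
  shows "exact_value (CVaR_cost \<alpha>) (CVaR_value \<alpha>)"
  unfolding exact_value_def using CVaR_cost_le_value CVaR_value_le_cost CVaR_value_le assms
  by (intro conjI exI[of _ "1 - \<alpha>"]) simp_all

lemma Exp_cost_eq_CVaR_cost: "schedule I \<pi> \<Longrightarrow> Exp_cost I \<pi> = CVaR_cost 0 I \<pi>"
  unfolding Exp_cost_def CVaR_cost_eq
  by (rule bounded_nat_pmf.expectation_eq_INF_rockafellar[OF cost_pmf_bounded])

lemma exact_value_Exp: "exact_value Exp_cost (CVaR_value 0)"
  using exact_value_CVaR[of 0] unfolding exact_value_def
  by (auto simp: Exp_cost_eq_CVaR_cost meets_def cong: conj_cong)

subsection \<open>Value at risk\<close>

text \<open>Vectors whose minimum is not an upper bound of the quantile get the trivial bound \<open>fmax\<close>.\<close>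

definition VaR_value :: "real \<Rightarrow> (nat \<Rightarrow> nat) \<Rightarrow> real" where
  "VaR_value \<alpha> t =
     (if \<alpha> \<le> (\<Sum>i<K. if t i \<le> minimum t then q i else 0) then real (minimum t) else real fmax)"

lemma VaR_cost_le_value:
  assumes \<alpha>: "0 < \<alpha>" "\<alpha> \<le> 1" and "meets t \<pi>"
  shows "VaR_cost \<alpha> I \<pi> \<le> VaR_value \<alpha> t"
proof -
  let ?prob = "\<lambda>x. measure_pmf.prob (cost_pmf I \<pi>) {..x}"
  have \<pi>: "schedule I \<pi>" using assms(3) by (simp add: meets_def)
  interpret bounded_nat_pmf "cost_pmf I \<pi>" fmax by (rule cost_pmf_bounded[OF \<pi>])
  obtain k where k: "k \<le> fmax" "VaR_cost \<alpha> I \<pi> = real k" "\<And>x. \<alpha> \<le> ?prob x \<Longrightarrow> real k \<le> x"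
    unfolding VaR_cost_def using quantile_at_nat[OF \<alpha>] by metis
  have "(\<Sum>i<K. if t i \<le> minimum t then q i else 0) \<le> ?prob (real (minimum t))"
    unfolding prob_cost using assms(3) by (intro sum_mono) (force simp: meets_def)
  then have "real k \<le> real (minimum t)" if "\<alpha> \<le> (\<Sum>i<K. if t i \<le> minimum t then q i else 0)"
    using that by (intro k(3)) linarith
  then show ?thesis using k(1,2) by (simp add: VaR_value_def)
qed

lemma VaR_value_le_cost:
  assumes \<alpha>: "0 < \<alpha>" "\<alpha> \<le> 1" and \<pi>: "schedule I \<pi>"
  shows "\<exists>t\<in>vectors. meets t \<pi> \<and> VaR_value \<alpha> t \<le> VaR_cost \<alpha> I \<pi>"
proof -
  let ?prob = "\<lambda>x. measure_pmf.prob (cost_pmf I \<pi>) {..x}"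
  interpret bounded_nat_pmf "cost_pmf I \<pi>" fmax by (rule cost_pmf_bounded[OF \<pi>])
  obtain k where k: "k \<le> fmax" "\<alpha> \<le> ?prob (real k)" "VaR_cost \<alpha> I \<pi> = real k"
    unfolding VaR_cost_def using quantile_at_nat[OF \<alpha>] by metis
  let ?t = "\<lambda>i. if i < K then if job_cost \<pi> i \<le> k then k else fmax else 0"
  have "\<exists>i<K. job_cost \<pi> i \<le> k"
  proof (rule ccontr)
    assume "\<not> ?thesis"
    then have "?prob (real k) = 0" by (simp add: prob_cost)
    then show False using k(2) \<alpha>(1) by simp
  qed
  then have "minimum ?t \<le> k" using minimum_le[of _ ?t] by fastforce
  then have min: "minimum ?t = k" using k(1) by (intro antisym) (auto simp: minimum_ge_iff)
  have "?prob (real k) \<le> (\<Sum>i<K. if ?t i \<le> minimum ?t then q i else 0)"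
    unfolding min prob_cost by (intro sum_mono) auto
  then have "VaR_value \<alpha> ?t = real k" using k(2) min by (simp add: VaR_value_def)
  moreover have "?t \<in> vectors" "meets ?t \<pi>"
    using job_cost_le[OF \<pi>] k(1) \<pi> by (auto simp: vectors_iff meets_def)
  ultimately show ?thesis using k(3) by auto
qed

lemma VaR_value_le: "t \<in> vectors \<Longrightarrow> VaR_value \<alpha> t \<le> real fmax"
  using minimum_le_fmax by (simp add: VaR_value_def)

lemma exact_value_VaR:
  assumes "0 < \<alpha>" "\<alpha> \<le> 1"
  shows "exact_value (VaR_cost \<alpha>) (VaR_value \<alpha>)"
  unfolding exact_value_def using VaR_cost_le_value VaR_value_le_cost VaR_value_le assms
  by (intro conjI exI[of _ 1]) simp_all

end

section \<open>Lawler's rule\<close>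

lemma ex_last_occurrence:
  assumes "V \<subseteq> set xs" "V \<noteq> {}"
  shows "\<exists>p<length xs. xs ! p \<in> V \<and> V \<subseteq> set (take (Suc p) xs)"
  using assms
proof (induction xs rule: rev_induct)
  case (snoc x xs)
  show ?case
  proof (cases "x \<in> V")
    case True
    then show ?thesis using snoc.prems by (intro exI[of _ "length xs"]) auto
  next
    case False
    then have "V \<subseteq> set xs" using snoc.prems by auto
    with snoc.IH snoc.prems(2) obtain p where
      "p < length xs" "xs ! p \<in> V" "V \<subseteq> set (take (Suc p) xs)"
      by blast
    then show ?thesis by (intro exI[of _ p]) (auto simp: nth_append)
  qed
qed simp

context bounded_instance begin

definition load :: "nat set \<Rightarrow> nat \<Rightarrow> nat" where
  "load V i = (\<Sum>j\<in>V. ptime I i j)"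

definition admissible :: "(nat \<Rightarrow> nat) \<Rightarrow> nat set \<Rightarrow> nat \<Rightarrow> bool" where
  "admissible t V x \<longleftrightarrow> (\<forall>s\<in>V. (x, s) \<notin> prec I) \<and>
     (\<forall>i<K. weight I x * load V i \<le> t i + weight I x * due I i x)"

lemma schedule_iff:
  "schedule I \<pi> \<longleftrightarrow> distinct \<pi> \<and> set \<pi> = {..<n} \<and>
     (\<forall>a<n. \<forall>b<n. (\<pi> ! a, \<pi> ! b) \<in> prec I \<longrightarrow> a < b)"
  by (auto simp: schedule_def permutations_of_set_def)

lemma length_if_set_eq: "distinct \<pi> \<Longrightarrow> set \<pi> = {..<n} \<Longrightarrow> length \<pi> = n"
  using distinct_card by fastforce

lemma completion_nth:
  assumes "distinct \<pi>" "p < length \<pi>"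
  shows "completion I \<pi> i (\<pi> ! p) = load (set (take (Suc p) \<pi>)) i"
proof -
  have "takeWhile (\<lambda>x. x \<noteq> \<pi> ! p) \<pi> = take p \<pi>"
    using assms by (intro takeWhile_eq_take_P_nth) (auto simp: nth_eq_iff_index_eq)
  then have "completion I \<pi> i (\<pi> ! p) = sum_list (map (ptime I i) (take (Suc p) \<pi>))"
    using assms by (simp add: completion_def take_Suc_conv_app_nth)
  also have "\<dots> = load (set (take (Suc p) \<pi>)) i"
    unfolding load_def using assms by (intro sum_list_distinct_conv_sum_set) auto
  finally show ?thesis .
qed

text \<open>The job of \<open>V\<close> that comes last in the schedule is admissible.\<close>

lemma ex_admissible_if_meets:
  assumes "meets t \<pi>" "V \<subseteq> {..<n}" "V \<noteq> {}"
  shows "\<exists>x\<in>V. admissible t V x"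
proof -
  have \<pi>: "distinct \<pi>" "set \<pi> = {..<n}" "\<And>a b. a < n \<Longrightarrow> b < n \<Longrightarrow> (\<pi> ! a, \<pi> ! b) \<in> prec I \<Longrightarrow> a < b"
    using assms(1) by (auto simp: meets_def schedule_iff)
  have len: "length \<pi> = n" using \<pi>(1,2) by (rule length_if_set_eq)
  obtain p where p: "p < n" "\<pi> ! p \<in> V" "V \<subseteq> set (take (Suc p) \<pi>)"
    using ex_last_occurrence[of V \<pi>] assms(2,3) \<pi>(2) len by auto
  have "(\<pi> ! p, s) \<notin> prec I" if s: "s \<in> V" for s
  proof -
    obtain a where "a \<le> p" "s = \<pi> ! a"
      using s p(1,3) len
      by (metis in_set_conv_nth length_take less_Suc_eq_le min_less_iff_conj nth_take subsetD)
    then show ?thesis using \<pi>(3)[of p a] p(1) by auto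
  qed
  moreover have "weight I (\<pi> ! p) * load V i \<le> t i + weight I (\<pi> ! p) * due I i (\<pi> ! p)"
    if "i < K" for i
  proof -
    have "load V i \<le> completion I \<pi> i (\<pi> ! p)"
      unfolding completion_nth[OF \<pi>(1) p(1)[folded len]] load_def
      using p(3) by (intro sum_mono2) auto
    then have "weight I (\<pi> ! p) * load V i \<le> weight I (\<pi> ! p) * completion I \<pi> i (\<pi> ! p)" by simp
    also have "\<dots> \<le> t i + weight I (\<pi> ! p) * due I i (\<pi> ! p)"
      using assms(1,2) p(2) that by (auto simp: meets_def job_cost_le_iff)
    finally show ?thesis .
  qed
  ultimately show ?thesis using p(2) by (auto simp: admissible_def)
qed

lemma meets_if_admissible:
  assumes \<pi>: "distinct \<pi>" "set \<pi> = {..<n}"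
    and adm: "\<And>p. p < n \<Longrightarrow> admissible t (set (take (Suc p) \<pi>)) (\<pi> ! p)"
  shows "meets t \<pi>"
proof -
  have len: "length \<pi> = n" using \<pi> by (rule length_if_set_eq)
  have "a < b" if "a < n" "b < n" "(\<pi> ! a, \<pi> ! b) \<in> prec I" for a b
  proof (rule ccontr)
    assume "\<not> a < b"
    then have "\<pi> ! b \<in> set (take (Suc a) \<pi>)"
      using that len by (auto simp: in_set_conv_nth intro!: exI[of _ b])
    then show False using adm[OF that(1)] that(3) by (auto simp: admissible_def)
  qed
  moreover have "job_cost \<pi> i \<le> t i" if i: "i < K" for i
    unfolding job_cost_le_iff
  proof (intro allI impI)
    fix j assume "j < n"
    then obtain p where p: "p < n" "j = \<pi> ! p"
      using \<pi>(2) len by (metis in_set_conv_nth lessThan_iff)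
    then show "weight I j * completion I \<pi> i j \<le> t i + weight I j * due I i j"
      using adm[OF p(1)] i completion_nth[OF \<pi>(1)] len by (simp add: admissible_def)
  qed
  ultimately show ?thesis using \<pi> by (simp add: meets_def schedule_iff)
qed

text \<open>Schedules are built from the last position to the first.\<close>

primrec greedy_tail :: "(nat \<Rightarrow> nat) \<Rightarrow> nat list \<Rightarrow> bool" where
  "greedy_tail t [] \<longleftrightarrow> True"
| "greedy_tail t (x # xs) \<longleftrightarrow>
     x \<in> {..<n} - set xs \<and> admissible t ({..<n} - set xs) x \<and> greedy_tail t xs"

lemma greedy_tail_distinct: "greedy_tail t xs \<Longrightarrow> distinct xs \<and> set xs \<subseteq> {..<n}"
  by (induction xs) auto

lemma greedy_tail_admissible:
  "greedy_tail t xs \<Longrightarrow> p < length xs \<Longrightarrow> admissible t ({..<n} - set (drop (Suc p) xs)) (xs ! p)"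
proof (induction xs arbitrary: p)
  case (Cons x xs)
  then show ?case by (cases p) auto
qed simp

lemma meets_if_greedy_tail:
  assumes "greedy_tail t \<pi>" "length \<pi> = n"
  shows "meets t \<pi>"
proof (rule meets_if_admissible)
  show \<pi>: "distinct \<pi>" using greedy_tail_distinct[OF assms(1)] ..
  show set: "set \<pi> = {..<n}"
    using greedy_tail_distinct[OF assms(1)] distinct_card[OF \<pi>] assms(2)
    by (intro card_subset_eq) auto
  fix p assume p: "p < n"
  have "set \<pi> = set (take (Suc p) \<pi>) \<union> set (drop (Suc p) \<pi>)"
    by (metis append_take_drop_id set_append)
  then have "set \<pi> - set (drop (Suc p) \<pi>) = set (take (Suc p) \<pi>)"
    using set_take_disj_set_drop_if_distinct[OF \<pi>, of "Suc p" "Suc p"] by auto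
  then show "admissible t (set (take (Suc p) \<pi>)) (\<pi> ! p)"
    using greedy_tail_admissible[OF assms(1), of p] assms(2) p set by simp
qed

lemma unscheduled_nonempty:
  assumes "length xs < n"
  shows "{..<n} - set xs \<noteq> {}"
proof
  assume "{..<n} - set xs = {}"
  then have "card {..<n} \<le> card (set xs)" by (intro card_mono) auto
  then show False using card_length[of xs] assms by simp
qed

lemma not_meets_if_stuck:
  assumes "length xs < n" "\<forall>x\<in>{..<n} - set xs. \<not> admissible t ({..<n} - set xs) x"
  shows "\<not> meets t \<pi>"
  using ex_admissible_if_meets[of t \<pi> "{..<n} - set xs"] unscheduled_nonempty[OF assms(1)] assms(2)
  by auto

lemma ex_greedy_tail:
  assumes "\<And>V. V \<subseteq> {..<n} \<Longrightarrow> V \<noteq> {} \<Longrightarrow> \<exists>x\<in>V. admissible t V x" "k \<le> n"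
  shows "\<exists>xs. greedy_tail t xs \<and> length xs = k"
  using assms(2)
proof (induction k)
  case (Suc k)
  then obtain xs where xs: "greedy_tail t xs" "length xs = k" by auto
  then have "{..<n} - set xs \<noteq> {}" using Suc.prems by (intro unscheduled_nonempty) simp
  then obtain x where "x \<in> {..<n} - set xs" "admissible t ({..<n} - set xs) x"
    using assms(1)[of "{..<n} - set xs"] by auto
  then show ?case using xs by (intro exI[of _ "x # xs"]) simp
qed simp

text \<open>For sufficiently large thresholds, Lawler's rule is topological sorting.\<close>

lemma ex_schedule: "\<exists>\<pi>. schedule I \<pi>"
proof -
  have "finite (prec I)"
    using valid by (auto simp: valid_instance_def intro: finite_subset)
  then have wf: "wf ((prec I)\<inverse>)"
    using valid by (intro finite_acyclic_wf_converse) (auto simp: valid_instance_def)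
  define t where "t i = (\<Sum>x<n. weight I x * load {..<n} i)" for i
  have "\<exists>x\<in>V. admissible t V x" if V: "V \<subseteq> {..<n}" "V \<noteq> {}" for V
  proof -
    obtain x where x: "x \<in> V" "\<And>y. (x, y) \<in> prec I \<Longrightarrow> y \<notin> V"
      using wfE_min[OF wf, of _ V] V(2) by auto
    have "weight I x * load V i \<le> t i" for i
    proof -
      have "weight I x * load V i \<le> weight I x * load {..<n} i"
        unfolding load_def using V(1) by (intro mult_left_mono sum_mono2) auto
      also have "\<dots> \<le> t i"
        unfolding t_def using x(1) V(1)
        by (intro member_le_sum[of x _ "\<lambda>x. weight I x * load {..<n} i"]) auto
      finally show ?thesis .
    qed
    then show ?thesis using x by (auto simp: admissible_def intro!: bexI[of _ x] trans_le_add1)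
  qed
  then obtain \<pi> where "greedy_tail t \<pi>" "length \<pi> = n" using ex_greedy_tail[of t n] by auto
  then show ?thesis using meets_if_greedy_tail by (auto simp: meets_def)
qed

end

section \<open>A structured language for the machine\<close>

text \<open>
  Index expressions denote natural numbers by construction, so no memory access gets stuck, and
  loop bounds are parameters, which no command assigns.  Hence every command denotes a total
  function on states, and its running time is bounded in terms of the parameters alone.
\<close>

datatype param_name =
  NumJobs | NumScens | MaxCost | NumVectors |
  WeightBase | PtimeBase | DueBase | ProbBase | PrecBase | WorkBase

datatype index_name = Vector | Position | Job | Candidate | Scenario

datatype scalar_name = Feasible | Violation | Carry | Digit | Minimum | Total | Value | BestValue

datatype array_name = Threshold | Unscheduled | Successors | Workload | Chosen | Best

datatype name = Param param_name | Index index_name | Scalar scalar_name | Array array_name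

instance param_name :: countable by countable_datatype
instance index_name :: countable by countable_datatype
instance scalar_name :: countable by countable_datatype
instance array_name :: countable by countable_datatype
instance name :: countable by countable_datatype

record state =
  param :: "param_name \<Rightarrow> nat"
  input :: "nat \<Rightarrow> real"
  index :: "index_name \<Rightarrow> nat"
  scalar :: "scalar_name \<Rightarrow> real"
  array :: "array_name \<Rightarrow> nat \<Rightarrow> real"

definition set_index :: "index_name \<Rightarrow> nat \<Rightarrow> state \<Rightarrow> state" where
  "set_index x k s = s\<lparr>index := (index s)(x := k)\<rparr>"

definition set_scalar :: "scalar_name \<Rightarrow> real \<Rightarrow> state \<Rightarrow> state" where
  "set_scalar x r s = s\<lparr>scalar := (scalar s)(x := r)\<rparr>"

definition set_array :: "array_name \<Rightarrow> nat \<Rightarrow> real \<Rightarrow> state \<Rightarrow> state" where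
  "set_array a k r s = s\<lparr>array := (array s)(a := (array s a)(k := r))\<rparr>"

lemma set_index_sel [simp]:
  "param (set_index x k s) = param s" "input (set_index x k s) = input s"
  "index (set_index x k s) = (index s)(x := k)"
  "scalar (set_index x k s) = scalar s" "array (set_index x k s) = array s"
  by (simp_all add: set_index_def)

lemma set_index_overwrite [simp]: "set_index x k (set_index x l s) = set_index x k s"
  by (simp add: set_index_def)

lemma set_index_triv: "index s x = k \<Longrightarrow> set_index x k s = s"
  by (auto simp: set_index_def)

lemma set_scalar_sel [simp]:
  "param (set_scalar x r s) = param s" "input (set_scalar x r s) = input s"
  "index (set_scalar x r s) = index s"
  "scalar (set_scalar x r s) = (scalar s)(x := r)" "array (set_scalar x r s) = array s"
  by (simp_all add: set_scalar_def)

lemma set_array_sel [simp]: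
  "param (set_array a k r s) = param s" "input (set_array a k r s) = input s"
  "index (set_array a k r s) = index s" "scalar (set_array a k r s) = scalar s"
  "array (set_array a k r s) = (array s)(a := (array s a)(k := r))"
  by (simp_all add: set_array_def)

text \<open>The arrays are interleaved behind the input, so that each of them is unbounded.\<close>

definition arrays :: "array_name list" where
  "arrays = [Threshold, Unscheduled, Successors, Workload, Chosen, Best]"

primrec slot :: "array_name \<Rightarrow> nat" where
  "slot Threshold = 0"
| "slot Unscheduled = 1"
| "slot Successors = 2"
| "slot Workload = 3"
| "slot Chosen = 4"
| "slot Best = 5"

definition memory :: "state \<Rightarrow> nat \<Rightarrow> real" where
  "memory s a =
     (if a < param s WorkBase then input s a
      else let k = a - param s WorkBase in array s (arrays ! (k mod 6)) (k div 6))"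

lemma slot_less: "slot a < 6"
  by (cases a) auto

lemma nth_arrays_slot: "arrays ! slot a = a"
  by (cases a) (auto simp: arrays_def)

lemma slot_nth_arrays: "k < 6 \<Longrightarrow> slot (arrays ! k) = k"
  by (auto simp: arrays_def less_Suc_eq numeral_eq_Suc)

lemma memory_input: "a < param s WorkBase \<Longrightarrow> memory s a = input s a"
  by (simp add: memory_def)

lemma memory_array: "memory s (param s WorkBase + (6 * k + slot a)) = array s a k"
  by (simp add: memory_def slot_less nth_arrays_slot)

lemma memory_set_index_scalar [simp]:
  "memory (set_index x k s) = memory s" "memory (set_scalar y r s) = memory s"
  by (simp_all add: memory_def fun_eq_iff)

lemma memory_set_array:
  "memory (set_array a k x s) = (memory s)(param s WorkBase + (6 * k + slot a) := x)"
proof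
  fix c
  show "memory (set_array a k x s) c = ((memory s)(param s WorkBase + (6 * k + slot a) := x)) c"
  proof (cases "c < param s WorkBase")
    case True
    then show ?thesis by (simp add: memory_def)
  next
    case False
    then obtain d where d: "c = param s WorkBase + d" by (metis le_Suc_ex not_less)
    have "d = 6 * k + slot a \<longleftrightarrow> arrays ! (d mod 6) = a \<and> d div 6 = k"
      using slot_less[of a] nth_arrays_slot[of a] slot_nth_arrays[of "d mod 6"]
        mult_div_mod_eq[of 6 d] by auto
    then show ?thesis by (auto simp: memory_def d)
  qed
qed

lemma memory_set_input:
  assumes "a < param s WorkBase"
  shows "memory (s\<lparr>input := (input s)(a := x)\<rparr>) = (memory s)(a := x)"
  using assms by (auto simp: memory_def fun_eq_iff)

subsection \<open>Expressions\<close>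

datatype iexp = INum nat | IPar param_name | IVar index_name | IAdd iexp iexp | IMul iexp iexp

datatype operator = Plus | Minus | Times

datatype rexp = OfIndex iexp | SVar scalar_name | Cell iexp | Op operator rexp rexp

primrec ieval :: "iexp \<Rightarrow> state \<Rightarrow> nat" where
  "ieval (INum c) s = c"
| "ieval (IPar p) s = param s p"
| "ieval (IVar x) s = index s x"
| "ieval (IAdd a b) s = ieval a s + ieval b s"
| "ieval (IMul a b) s = ieval a s * ieval b s"

primrec apply_op :: "operator \<Rightarrow> real \<Rightarrow> real \<Rightarrow> real" where
  "apply_op Plus x y = x + y"
| "apply_op Minus x y = x - y"
| "apply_op Times x y = x * y"

primrec reval :: "rexp \<Rightarrow> state \<Rightarrow> real" where
  "reval (OfIndex e) s = real (ieval e s)"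
| "reval (SVar x) s = scalar s x"
| "reval (Cell e) s = memory s (ieval e s)"
| "reval (Op f a b) s = apply_op f (reval a s) (reval b s)"

lemmas reval_Op = reval.simps(4)

abbreviation num :: "nat \<Rightarrow> rexp" where "num c \<equiv> OfIndex (INum c)"
abbreviation radd :: "rexp \<Rightarrow> rexp \<Rightarrow> rexp" (infixl "\<oplus>" 65) where "a \<oplus> b \<equiv> Op Plus a b"
abbreviation rsub :: "rexp \<Rightarrow> rexp \<Rightarrow> rexp" (infixl "\<ominus>" 65) where "a \<ominus> b \<equiv> Op Minus a b"
abbreviation rmul :: "rexp \<Rightarrow> rexp \<Rightarrow> rexp" (infixl "\<otimes>" 70) where "a \<otimes> b \<equiv> Op Times a b"

definition address :: "array_name \<Rightarrow> iexp \<Rightarrow> iexp" where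
  "address a e = IAdd (IPar WorkBase) (IAdd (IMul (INum 6) e) (INum (slot a)))"

definition elem :: "array_name \<Rightarrow> iexp \<Rightarrow> rexp" where
  "elem a e = Cell (address a e)"

lemma ieval_address: "ieval (address a e) s = param s WorkBase + (6 * ieval e s + slot a)"
  by (simp add: address_def)

lemma reval_elem [simp]: "reval (elem a e) s = array s a (ieval e s)"
  by (simp add: elem_def ieval_address memory_array)

subsection \<open>Commands\<close>

datatype cmd =
    Nop
  | SetIndex index_name iexp
  | SetScalar scalar_name rexp
  | SetArray array_name iexp rexp
  | Then cmd cmd (infixr ";;" 60)
  | Cond rexp rexp cmd cmd
  | For index_name param_name cmd

primrec run :: "cmd \<Rightarrow> state \<Rightarrow> state" where
  "run Nop s = s"
| "run (SetIndex x e) s = set_index x (ieval e s) s"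
| "run (SetScalar x e) s = set_scalar x (reval e s) s"
| "run (SetArray a k e) s = set_array a (ieval k s) (reval e s) s"
| "run (c ;; c') s = run c' (run c s)"
| "run (Cond a b c c') s = (if reval a s \<le> reval b s then run c s else run c' s)"
| "run (For x p c) s =
     set_index x (param s p) (fold (\<lambda>k s. run c (set_index x k s)) [0..<param s p] s)"

lemmas run_Then = run.simps(5)
lemmas run_For = run.simps(7)

primrec writes :: "cmd \<Rightarrow> name set" where
  "writes Nop = {}"
| "writes (SetIndex x e) = {Index x}"
| "writes (SetScalar x e) = {Scalar x}"
| "writes (SetArray a k e) = {Array a}"
| "writes (c ;; c') = writes c \<union> writes c'"
| "writes (Cond a b c c') = writes c \<union> writes c'"
| "writes (For x p c) = insert (Index x) (writes c)"

text \<open>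
  A loop body must not assign the counter: \<^const>\<open>run\<close> sets it afresh in every iteration, whereas
  the compiled loop increments it.
\<close>

primrec well_formed :: "cmd \<Rightarrow> bool" where
  "well_formed Nop \<longleftrightarrow> True"
| "well_formed (SetIndex x e) \<longleftrightarrow> True"
| "well_formed (SetScalar x e) \<longleftrightarrow> True"
| "well_formed (SetArray a k e) \<longleftrightarrow> True"
| "well_formed (c ;; c') \<longleftrightarrow> well_formed c \<and> well_formed c'"
| "well_formed (Cond a b c c') \<longleftrightarrow> well_formed c \<and> well_formed c'"
| "well_formed (For x p c) \<longleftrightarrow> Index x \<notin> writes c \<and> well_formed c"

definition unchanged :: "name set \<Rightarrow> state \<Rightarrow> state \<Rightarrow> bool" where
  "unchanged X s s' \<longleftrightarrow> param s' = param s \<and> input s' = input s \<and>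
     (\<forall>x. Index x \<notin> X \<longrightarrow> index s' x = index s x) \<and>
     (\<forall>x. Scalar x \<notin> X \<longrightarrow> scalar s' x = scalar s x) \<and>
     (\<forall>a. Array a \<notin> X \<longrightarrow> array s' a = array s a)"

lemma unchanged_trans:
  "unchanged X s s' \<Longrightarrow> unchanged Y s' s'' \<Longrightarrow> unchanged (X \<union> Y) s s''"
  by (auto simp: unchanged_def)

lemma unchanged_mono: "unchanged X s s' \<Longrightarrow> X \<subseteq> Y \<Longrightarrow> unchanged Y s s'"
  by (auto simp: unchanged_def)

lemma unchanged_run: "unchanged (writes c) s (run c s)"
proof (induction c arbitrary: s)
  case (Then c c')
  then show ?case using unchanged_trans by fastforce
next
  case (Cond a b c c')
  then show ?case by (auto intro: unchanged_mono)
next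
  case (For x p c)
  let ?X = "writes (For x p c)"
  have "unchanged ?X s (fold (\<lambda>k s. run c (set_index x k s)) ks s)" for ks
  proof (induction ks rule: rev_induct)
    case Nil
    then show ?case by (simp add: unchanged_def)
  next
    case (snoc k ks)
    let ?s = "fold (\<lambda>k s. run c (set_index x k s)) ks s"
    have "unchanged ?X ?s (run c (set_index x k ?s))"
      using For[of "set_index x k ?s"] by (auto simp: unchanged_def)
    from unchanged_trans[OF snoc this] show ?case by simp
  qed
  from this[of "[0..<param s p]"] show ?case by (simp add: unchanged_def)
qed (auto simp: unchanged_def)

lemma run_unchanged [simp]:
  "param (run c s) = param s"
  "input (run c s) = input s"
  "Index x \<notin> writes c \<Longrightarrow> index (run c s) x = index s x"
  "Scalar y \<notin> writes c \<Longrightarrow> scalar (run c s) y = scalar s y"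
  "Array a \<notin> writes c \<Longrightarrow> array (run c s) a = array s a"
  using unchanged_run[of c s] by (auto simp: unchanged_def)

lemma run_For_induct:
  assumes init: "J 0 s"
    and step: "\<And>k s'. \<lbrakk>k < param s p; unchanged (writes (For x p c)) s s'; J k s'\<rbrakk>
      \<Longrightarrow> J (Suc k) (run c (set_index x k s'))"
    and final: "\<And>s'. \<lbrakk>unchanged (writes (For x p c)) s s'; J (param s p) s'\<rbrakk>
      \<Longrightarrow> Q (set_index x (param s p) s')"
  shows "Q (run (For x p c) s)"
proof -
  let ?S = "\<lambda>k. fold (\<lambda>k s. run c (set_index x k s)) [0..<k] s"
  have "unchanged (writes (For x p c)) s (?S k) \<and> J k (?S k)" if "k \<le> param s p" for k
    using that
  proof (induction k)
    case 0
    then show ?case using init by (simp add: unchanged_def)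
  next
    case (Suc k)
    then have IH: "unchanged (writes (For x p c)) s (?S k)" "J k (?S k)" and k: "k < param s p"
      by auto
    have "unchanged (writes (For x p c)) s (run c (set_index x k (?S k)))"
      using IH(1) unchanged_run[of c "set_index x k (?S k)"] by (auto simp: unchanged_def)
    then show ?case using step[OF k IH] by simp
  qed
  then show ?thesis using final[of "?S (param s p)"] by simp
qed

declare run_For [simp del]

section \<open>Compilation\<close>

text \<open>Even registers hold the variables, odd registers form the evaluation stack.\<close>

definition loc :: "name \<Rightarrow> nat" where
  "loc x = 2 * to_nat x"

definition tmp :: "nat \<Rightarrow> nat" where
  "tmp d = 2 * d + 1"

lemma loc_eq_iff [simp]: "loc x = loc y \<longleftrightarrow> x = y"
  by (simp add: loc_def)

lemma tmp_eq_iff [simp]: "tmp d = tmp e \<longleftrightarrow> d = e"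
  by (simp add: tmp_def)

lemma loc_neq_tmp [simp]: "loc x \<noteq> tmp d" "tmp d \<noteq> loc x"
  unfolding loc_def tmp_def by presburger+

primrec instruction :: "operator \<Rightarrow> nat \<Rightarrow> nat \<Rightarrow> nat \<Rightarrow> ram" where
  "instruction Plus = Add"
| "instruction Minus = Sub"
| "instruction Times = Mul"

definition copy :: "nat \<Rightarrow> nat \<Rightarrow> ram" where
  "copy r r' = Seq (Const r 0) (Add r r r')"

definition binary :: "operator \<Rightarrow> nat \<Rightarrow> ram \<Rightarrow> ram \<Rightarrow> ram" where
  "binary f d P Q = Seq (Seq P Q) (instruction f (tmp d) (tmp d) (tmp (Suc d)))"

primrec icode :: "iexp \<Rightarrow> nat \<Rightarrow> ram" where
  "icode (INum c) d = Const (tmp d) c"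
| "icode (IPar p) d = copy (tmp d) (loc (Param p))"
| "icode (IVar x) d = copy (tmp d) (loc (Index x))"
| "icode (IAdd a b) d = binary Plus d (icode a d) (icode b (Suc d))"
| "icode (IMul a b) d = binary Times d (icode a d) (icode b (Suc d))"

primrec icost :: "iexp \<Rightarrow> nat" where
  "icost (INum c) = 1"
| "icost (IPar p) = 2"
| "icost (IVar x) = 2"
| "icost (IAdd a b) = icost a + icost b + 1"
| "icost (IMul a b) = icost a + icost b + 1"

primrec rcode :: "rexp \<Rightarrow> nat \<Rightarrow> ram" where
  "rcode (OfIndex e) d = icode e d"
| "rcode (SVar x) d = copy (tmp d) (loc (Scalar x))"
| "rcode (Cell e) d = Seq (icode e d) (Load (tmp d) (tmp d))"
| "rcode (Op f a b) d = binary f d (rcode a d) (rcode b (Suc d))"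

primrec rcost :: "rexp \<Rightarrow> nat" where
  "rcost (OfIndex e) = icost e"
| "rcost (SVar x) = 2"
| "rcost (Cell e) = icost e + 1"
| "rcost (Op f a b) = rcost a + rcost b + 1"

definition assign :: "name \<Rightarrow> ram \<Rightarrow> ram" where
  "assign x P = Seq P (copy (loc x) (tmp 0))"

definition store_code :: "ram \<Rightarrow> ram \<Rightarrow> ram" where
  "store_code P Q = Seq (Seq P Q) (Store (tmp 0) (tmp 1))"

definition loop_test :: "index_name \<Rightarrow> param_name \<Rightarrow> ram" where
  "loop_test x p = Seq (icode (IAdd (IVar x) (INum 1)) 0) (icode (IPar p) 1)"

definition set_and_test :: "index_name \<Rightarrow> iexp \<Rightarrow> param_name \<Rightarrow> ram" where
  "set_and_test x e p = Seq (assign (Index x) (icode e 0)) (loop_test x p)"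

definition for_code :: "index_name \<Rightarrow> param_name \<Rightarrow> ram \<Rightarrow> ram" where
  "for_code x p P = Seq (set_and_test x (INum 0) p)
     (WhileLe (tmp 0) (tmp 1) (Seq P (set_and_test x (IAdd (IVar x) (INum 1)) p)))"

primrec compile :: "cmd \<Rightarrow> ram" where
  "compile Nop = Skip"
| "compile (SetIndex x e) = assign (Index x) (icode e 0)"
| "compile (SetScalar x e) = assign (Scalar x) (rcode e 0)"
| "compile (SetArray a k e) = store_code (icode (address a k) 0) (rcode e 1)"
| "compile (c ;; c') = Seq (compile c) (compile c')"
| "compile (Cond a b c c') =
     Seq (Seq (rcode a 0) (rcode b 1)) (IfLe (tmp 0) (tmp 1) (compile c) (compile c'))"
| "compile (For x p c) = for_code x p (compile c)"

primrec cost :: "(param_name \<Rightarrow> nat) \<Rightarrow> cmd \<Rightarrow> nat" where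
  "cost \<rho> Nop = 1"
| "cost \<rho> (SetIndex x e) = icost e + 2"
| "cost \<rho> (SetScalar x e) = rcost e + 2"
| "cost \<rho> (SetArray a k e) = icost k + rcost e + 8"
| "cost \<rho> (c ;; c') = cost \<rho> c + cost \<rho> c'"
| "cost \<rho> (Cond a b c c') = rcost a + rcost b + 1 + max (cost \<rho> c) (cost \<rho> c')"
| "cost \<rho> (For x p c) = \<rho> p * (cost \<rho> c + 13) + 10"

subsection \<open>Correctness\<close>

definition represents :: "state \<Rightarrow> (nat \<Rightarrow> real) \<Rightarrow> bool" where
  "represents s R \<longleftrightarrow> (\<forall>p. R (loc (Param p)) = real (param s p)) \<and>
     (\<forall>x. R (loc (Index x)) = real (index s x)) \<and> (\<forall>x. R (loc (Scalar x)) = scalar s x)"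

definition computes :: "ram \<Rightarrow> nat \<Rightarrow> nat \<Rightarrow> state \<Rightarrow> real \<Rightarrow> bool" where
  "computes P T d s x \<longleftrightarrow> (\<forall>R. represents s R \<longrightarrow> (\<exists>R'.
     exec P (R, memory s) T (R', memory s) \<and> represents s R' \<and>
     R' (tmp d) = x \<and> (\<forall>e<d. R' (tmp e) = R (tmp e))))"

definition realizes :: "ram \<Rightarrow> nat \<Rightarrow> state \<Rightarrow> state \<Rightarrow> bool" where
  "realizes P T s s' \<longleftrightarrow> (\<forall>R. represents s R \<longrightarrow> (\<exists>t R'.
     exec P (R, memory s) t (R', memory s') \<and> t \<le> T \<and> represents s' R'))"

lemma represents_tmp [simp]: "represents s (R(tmp d := x)) \<longleftrightarrow> represents s R"
  by (simp add: represents_def)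

lemma computesE:
  assumes "computes P T d s x" "represents s R"
  obtains R' where "exec P (R, memory s) T (R', memory s)" "represents s R'"
    "R' (tmp d) = x" "\<forall>e<d. R' (tmp e) = R (tmp e)"
  using assms unfolding computes_def by blast

lemma realizesE:
  assumes "realizes P T s s'" "represents s R"
  obtains t R' where "exec P (R, memory s) t (R', memory s')" "t \<le> T" "represents s' R'"
  using assms unfolding realizes_def by blast

lemma exec_copy: "r \<noteq> r' \<Longrightarrow> exec (copy r r') (R, M) 2 (R(r := R r'), M)"
  using exec.Seq[OF exec.Const[of r 0 R M] exec.Add[of r r r']]
  by (simp add: copy_def numeral_2_eq_2)

lemma exec_instruction:
  "exec (instruction f r a b) (R, M) 1 (R(r := apply_op f (R a) (R b)), M)"
  by (cases f) (simp_all add: exec.Add exec.Sub exec.Mul del: One_nat_def)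

lemma exec_pair:
  assumes "computes P T d s x" "computes Q U (Suc d) s y" "represents s R"
  obtains R' where "exec (Seq P Q) (R, memory s) (T + U) (R', memory s)" "represents s R'"
    "R' (tmp d) = x" "R' (tmp (Suc d)) = y" "\<forall>e<d. R' (tmp e) = R (tmp e)"
proof -
  from assms(1,3) obtain R1 where R1: "exec P (R, memory s) T (R1, memory s)" "represents s R1"
    "R1 (tmp d) = x" "\<forall>e<d. R1 (tmp e) = R (tmp e)"
    by (rule computesE)
  from assms(2) R1(2) obtain R2 where R2: "exec Q (R1, memory s) U (R2, memory s)" "represents s R2"
    "R2 (tmp (Suc d)) = y" "\<forall>e<Suc d. R2 (tmp e) = R1 (tmp e)"
    by (rule computesE)
  show thesis
    by (rule that[OF exec.Seq[OF R1(1) R2(1)] R2(2)]) (simp_all add: R1(3,4) R2(3,4))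
qed

lemma computes_copy:
  assumes "\<And>R. represents s R \<Longrightarrow> R (loc v) = x"
  shows "computes (copy (tmp d) (loc v)) 2 d s x"
  unfolding computes_def
proof (intro allI impI)
  fix R assume "represents s R"
  then show "\<exists>R'. exec (copy (tmp d) (loc v)) (R, memory s) 2 (R', memory s) \<and> represents s R' \<and>
      R' (tmp d) = x \<and> (\<forall>e<d. R' (tmp e) = R (tmp e))"
    using assms exec_copy[of "tmp d" "loc v"] by (intro exI[of _ "R(tmp d := x)"]) auto
qed

lemma computes_binary:
  assumes "computes P T d s x" "computes Q U (Suc d) s y"
  shows "computes (binary f d P Q) (T + U + 1) d s (apply_op f x y)"
  unfolding computes_def
proof (intro allI impI)
  fix R assume "represents s R"
  with assms obtain R' where R': "exec (Seq P Q) (R, memory s) (T + U) (R', memory s)"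
    "represents s R'" "R' (tmp d) = x" "R' (tmp (Suc d)) = y" "\<forall>e<d. R' (tmp e) = R (tmp e)"
    by (rule exec_pair)
  let ?R = "R'(tmp d := apply_op f x y)"
  have "exec (binary f d P Q) (R, memory s) (T + U + 1) (?R, memory s)"
    using exec.Seq[OF R'(1) exec_instruction[of f "tmp d" "tmp d" "tmp (Suc d)"]] R'(3,4)
    by (simp add: binary_def)
  then show "\<exists>R'. exec (binary f d P Q) (R, memory s) (T + U + 1) (R', memory s) \<and> represents s R' \<and>
      R' (tmp d) = apply_op f x y \<and> (\<forall>e<d. R' (tmp e) = R (tmp e))"
    using R'(2,5) by (intro exI[of _ ?R]) simp
qed

lemma computes_icode: "computes (icode e d) (icost e) d s (real (ieval e s))"
proof (induction e arbitrary: d)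
  case (INum c)
  show ?case
    unfolding computes_def
    by (auto intro!: exI[of _ "_(tmp d := real c)"] simp: exec.Const[unfolded One_nat_def])
next
  case (IAdd a b)
  then show ?case using computes_binary[of _ _ _ _ _ _ _ _ Plus] by simp
next
  case (IMul a b)
  then show ?case using computes_binary[of _ _ _ _ _ _ _ _ Times] by simp
next
  case (IPar p)
  show ?case by (simp, rule computes_copy) (simp add: represents_def)
next
  case (IVar x)
  show ?case by (simp, rule computes_copy) (simp add: represents_def)
qed

lemma computes_load:
  assumes "computes P T d s (real k)"
  shows "computes (Seq P (Load (tmp d) (tmp d))) (T + 1) d s (memory s k)"
  unfolding computes_def
proof (intro allI impI)
  fix R assume "represents s R"
  with assms obtain R' where R': "exec P (R, memory s) T (R', memory s)" "represents s R'"
    "R' (tmp d) = real k" "\<forall>e<d. R' (tmp e) = R (tmp e)"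
    by (rule computesE)
  show "\<exists>R'. exec (Seq P (Load (tmp d) (tmp d))) (R, memory s) (T + 1) (R', memory s) \<and>
      represents s R' \<and> R' (tmp d) = memory s k \<and> (\<forall>e<d. R' (tmp e) = R (tmp e))"
    using exec.Seq[OF R'(1) exec.Load[of R' "tmp d", OF R'(3), of "tmp d"]] R'(2,4)
    by (intro exI[of _ "R'(tmp d := memory s k)"]) simp
qed

lemma computes_rcode: "computes (rcode e d) (rcost e) d s (reval e s)"
proof (induction e arbitrary: d)
  case (OfIndex e)
  then show ?case using computes_icode by simp
next
  case (Cell e)
  then show ?case using computes_load[OF computes_icode] by simp
next
  case (Op f a b)
  then show ?case using computes_binary by simp
next
  case (SVar x)
  show ?case by (simp, rule computes_copy) (simp add: represents_def)
qed

lemma realizes_Seq: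
  assumes "realizes P T s s'" "realizes Q U s' s''"
  shows "realizes (Seq P Q) (T + U) s s''"
  unfolding realizes_def
proof (intro allI impI)
  fix R assume "represents s R"
  with assms(1) obtain t R' where
    R': "exec P (R, memory s) t (R', memory s')" "t \<le> T" "represents s' R'"
    by (rule realizesE)
  from assms(2) R'(3) obtain u R'' where
    "exec Q (R', memory s') u (R'', memory s'')" "u \<le> U" "represents s'' R''"
    by (rule realizesE)
  with R' show "\<exists>t R'. exec (Seq P Q) (R, memory s) t (R', memory s'') \<and>
      t \<le> T + U \<and> represents s'' R'"
    by (intro exI[of _ "t + u"] exI[of _ R'']) (auto intro: exec.Seq)
qed

lemma realizes_mono: "realizes P T s s' \<Longrightarrow> T \<le> T' \<Longrightarrow> realizes P T' s s'"
  unfolding realizes_def by (meson le_trans)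

lemma realizes_assign:
  assumes P: "computes P T 0 s x"
    and s': "memory s' = memory s" "\<And>R. represents s R \<Longrightarrow> represents s' (R(loc v := x))"
  shows "realizes (assign v P) (T + 2) s s'"
  unfolding realizes_def
proof (intro allI impI)
  fix R assume "represents s R"
  with P obtain R' where
    R': "exec P (R, memory s) T (R', memory s)" "represents s R'" "R' (tmp 0) = x"
    by (rule computesE) blast
  have "exec (assign v P) (R, memory s) (T + 2) (R'(loc v := x), memory s')"
    unfolding assign_def s'(1) using exec.Seq[OF R'(1) exec_copy[of "loc v" "tmp 0"]] R'(3) by simp
  then show "\<exists>t R'. exec (assign v P) (R, memory s) t (R', memory s') \<and>
      t \<le> T + 2 \<and> represents s' R'"
    using s'(2)[OF R'(2)] by blast
qed

lemma realizes_set_index: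
  "computes P T 0 s (real k) \<Longrightarrow> realizes (assign (Index x) P) (T + 2) s (set_index x k s)"
  by (rule realizes_assign) (auto simp: represents_def)

lemma realizes_store:
  assumes P: "computes P T 0 s (real k)" and Q: "computes Q U 1 s x"
    and s': "memory s' = (memory s)(k := x)" "param s' = param s"
      "index s' = index s" "scalar s' = scalar s"
  shows "realizes (store_code P Q) (T + U + 1) s s'"
  unfolding realizes_def
proof (intro allI impI)
  fix R assume "represents s R"
  with P Q[unfolded One_nat_def] obtain R' where
    R': "exec (Seq P Q) (R, memory s) (T + U) (R', memory s)"
      "represents s R'" "R' (tmp 0) = real k" "R' (tmp (Suc 0)) = x"
    by (rule exec_pair)
  have "exec (store_code P Q) (R, memory s) (T + U + 1) (R', memory s')"
    using exec.Seq[OF R'(1) exec.Store[of R' "tmp 0", OF R'(3), of "tmp 1"]] R'(4)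
    by (simp add: store_code_def s'(1))
  moreover have "represents s' R'" using R'(2) s'(2-4) by (simp add: represents_def)
  ultimately show "\<exists>t R'. exec (store_code P Q) (R, memory s) t (R', memory s') \<and>
      t \<le> T + U + 1 \<and> represents s' R'" by blast
qed

lemma exec_WhileLe_count:
  assumes step: "\<And>k st. k < N \<Longrightarrow> J k st \<Longrightarrow> \<exists>t st'. exec P st t st' \<and> t \<le> T \<and> J (Suc k) st'"
    and guard: "\<And>k st. J k st \<Longrightarrow> fst st a \<le> fst st b \<longleftrightarrow> k < N"
    and "J k st" "k \<le> N"
  shows "\<exists>t st'. exec (WhileLe a b P) st t st' \<and> t \<le> (N - k) * (T + 1) + 1 \<and> J N st'"
  using assms(3,4)
proof (induction "N - k" arbitrary: k st)
  case 0
  then have "exec (WhileLe a b P) st 1 st" using guard by (intro exec.WhileFalse) auto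
  moreover have "k = N" using 0 by simp
  ultimately show ?case using 0(2) by (intro exI[of _ 1] exI[of _ st]) simp
next
  case (Suc m)
  then have "k < N" and le: "fst st a \<le> fst st b" using guard by auto
  with step Suc.prems obtain t st1 where t: "exec P st t st1" "t \<le> T" "J (Suc k) st1" by blast
  have "m = N - Suc k" "Suc k \<le> N" using Suc.hyps(2) \<open>k < N\<close> by simp_all
  with Suc.hyps(1) t(3) obtain u st2 where
    u: "exec (WhileLe a b P) st1 u st2" "u \<le> (N - Suc k) * (T + 1) + 1" "J N st2"
    by blast
  have "N - k = Suc (N - Suc k)" using \<open>k < N\<close> by simp
  then have "Suc (t + u) \<le> (N - k) * (T + 1) + 1" using t(2) u(2) by simp
  then show ?case using exec.WhileTrue[OF le t(1) u(1)] u(3) by blast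
qed

lemma exec_loop_test:
  assumes "represents s R"
  obtains R' where "exec (loop_test x p) (R, memory s) 6 (R', memory s)" "represents s R'"
    "R' (tmp 0) = real (index s x + 1)" "R' (tmp 1) = real (param s p)"
proof -
  have "computes (icode (IAdd (IVar x) (INum 1)) 0) 4 0 s (real (index s x + 1))"
    "computes (icode (IPar p) (Suc 0)) 2 (Suc 0) s (real (param s p))"
    using computes_icode[of "IAdd (IVar x) (INum 1)" 0 s] computes_icode[of "IPar p" 1 s]
    by simp_all
  then obtain R' where "exec (Seq (icode (IAdd (IVar x) (INum 1)) 0) (icode (IPar p) (Suc 0)))
      (R, memory s) (4 + 2) (R', memory s)" "represents s R'"
    "R' (tmp 0) = real (index s x + 1)" "R' (tmp (Suc 0)) = real (param s p)"
    using assms by (rule exec_pair)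
  then show thesis using that by (simp add: loop_test_def)
qed

definition loop_ready :: "index_name \<Rightarrow> param_name \<Rightarrow> state \<Rightarrow> store \<Rightarrow> bool" where
  "loop_ready x p s st \<longleftrightarrow> represents s (fst st) \<and> snd st = memory s \<and>
     fst st (tmp 0) = real (index s x + 1) \<and> fst st (tmp 1) = real (param s p)"

lemma exec_set_and_test:
  assumes "represents s R"
  shows "\<exists>t st. exec (set_and_test x e p) (R, memory s) t st \<and> t \<le> icost e + 8 \<and>
    loop_ready x p (set_index x (ieval e s) s) st"
proof -
  let ?s = "set_index x (ieval e s) s"
  have "realizes (assign (Index x) (icode e 0)) (icost e + 2) s ?s"
    by (intro realizes_set_index computes_icode)
  from this assms obtain t R1 where
    R1: "exec (assign (Index x) (icode e 0)) (R, memory s) t (R1, memory ?s)"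
      "t \<le> icost e + 2" "represents ?s R1"
    by (rule realizesE)
  from R1(3) obtain R2 where
    R2: "exec (loop_test x p) (R1, memory ?s) 6 (R2, memory ?s)" "represents ?s R2"
      "R2 (tmp 0) = real (index ?s x + 1)" "R2 (tmp 1) = real (param ?s p)"
    by (rule exec_loop_test)
  have "exec (set_and_test x e p) (R, memory s) (t + 6) (R2, memory ?s)"
    unfolding set_and_test_def by (rule exec.Seq[OF R1(1) R2(1)])
  moreover have "loop_ready x p ?s (R2, memory ?s)" using R2(2-4) by (simp add: loop_ready_def)
  moreover have "t + 6 \<le> icost e + 8" using R1(2) by simp
  ultimately show ?thesis by blast
qed

lemma exec_loop_body:
  assumes P: "realizes P T (set_index x k s) (set_index x k s')"
    and st: "loop_ready x p (set_index x k s) st"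
  shows "\<exists>t st'. exec (Seq P (set_and_test x (IAdd (IVar x) (INum 1)) p)) st t st' \<and> t \<le> T + 12 \<and>
    loop_ready x p (set_index x (Suc k) s') st'"
proof -
  have "represents (set_index x k s) (fst st)" "st = (fst st, memory (set_index x k s))"
    using st by (simp_all add: loop_ready_def prod_eq_iff)
  with P obtain t R where
    R: "exec P st t (R, memory (set_index x k s'))" "t \<le> T" "represents (set_index x k s') R"
    by (metis realizesE)
  obtain u st' where st': "exec (set_and_test x (IAdd (IVar x) (INum 1)) p)
      (R, memory (set_index x k s')) u st'" "u \<le> 12" "loop_ready x p (set_index x (Suc k) s') st'"
    using exec_set_and_test[OF R(3), of x "IAdd (IVar x) (INum 1)" p] by auto
  have "t + u \<le> T + 12" using R(2) st'(2) by simp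
  then show ?thesis using exec.Seq[OF R(1) st'(1)] st'(3) by blast
qed

lemma realizes_for_code:
  assumes N: "\<And>k. k \<le> N \<Longrightarrow> param (S k) p = N"
    and body: "\<And>k. k < N \<Longrightarrow> realizes P T (set_index x k (S k)) (set_index x k (S (Suc k)))"
  shows "realizes (for_code x p P) (N * (T + 13) + 10) (S 0) (set_index x N (S N))"
  unfolding realizes_def
proof (intro allI impI)
  let ?body = "Seq P (set_and_test x (IAdd (IVar x) (INum 1)) p)"
  define J where "J k st \<longleftrightarrow> k \<le> N \<and> loop_ready x p (set_index x k (S k)) st" for k st
  have step: "\<exists>t st'. exec ?body st t st' \<and> t \<le> T + 12 \<and> J (Suc k) st'" if "k < N" "J k st" for k st
    using exec_loop_body[OF body] that by (simp add: J_def Suc_leI)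
  have guard: "fst st (tmp 0) \<le> fst st (tmp 1) \<longleftrightarrow> k < N" if "J k st" for k st
    using that N by (auto simp: J_def loop_ready_def)
  fix R assume "represents (S 0) R"
  then obtain t st where
    st: "exec (set_and_test x (INum 0) p) (R, memory (S 0)) t st" "t \<le> 9" "J 0 st"
    using exec_set_and_test[of "S 0" R x "INum 0" p] by (auto simp: J_def)
  obtain u st' where st': "exec (WhileLe (tmp 0) (tmp 1) ?body) st u st'"
    "u \<le> N * (T + 12 + 1) + 1" "J N st'"
    using exec_WhileLe_count[of N J _ "T + 12", OF step guard st(3)]
    by (auto simp del: mult_Suc_right)
  have "exec (for_code x p P) (R, memory (S 0)) (t + u) st'"
    unfolding for_code_def by (rule exec.Seq[OF st(1) st'(1)])
  moreover have "t + u \<le> N * (T + 13) + 10" using st(2) st'(2) by (simp add: algebra_simps)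
  moreover have "st' = (fst st', memory (set_index x N (S N)))"
    "represents (set_index x N (S N)) (fst st')"
    using st'(3) by (simp_all add: J_def loop_ready_def prod_eq_iff)
  ultimately show "\<exists>t R'.
      exec (for_code x p P) (R, memory (S 0)) t (R', memory (set_index x N (S N))) \<and>
      t \<le> N * (T + 13) + 10 \<and> represents (set_index x N (S N)) R'"
    by metis
qed

lemma realizes_For:
  assumes x: "Index x \<notin> writes c"
    and body: "\<And>s. realizes (compile c) (cost (param s) c) s (run c s)"
  shows "realizes (compile (For x p c)) (cost (param s) (For x p c)) s (run (For x p c) s)"
proof -
  let ?S = "\<lambda>k. fold (\<lambda>k s. run c (set_index x k s)) [0..<k] s"
  have param: "param (?S k) = param s" for k by (induction k) auto
  have "realizes (for_code x p (compile c)) (param s p * (cost (param s) c + 13) + 10) (?S 0)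
      (set_index x (param s p) (?S (param s p)))"
  proof (rule realizes_for_code)
    fix k
    let ?s = "set_index x k (?S k)"
    have "set_index x k (?S (Suc k)) = run c ?s" using x by (simp add: set_index_triv)
    then show "realizes (compile c) (cost (param s) c) ?s (set_index x k (?S (Suc k)))"
      using body[of ?s] param by simp
  qed (simp add: param)
  then show ?thesis by (simp add: run_For)
qed

lemma realizes_Cond:
  assumes "reval a s \<le> reval b s \<Longrightarrow> realizes P T s s'" "\<not> reval a s \<le> reval b s \<Longrightarrow> realizes Q U s s'"
  shows "realizes (Seq (Seq (rcode a 0) (rcode b 1)) (IfLe (tmp 0) (tmp 1) P Q))
    (rcost a + rcost b + 1 + max T U) s s'"
  unfolding realizes_def
proof (intro allI impI)
  fix R assume "represents s R"
  with computes_rcode computes_rcode obtain R1 where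
    R1: "exec (Seq (rcode a 0) (rcode b (Suc 0))) (R, memory s) (rcost a + rcost b) (R1, memory s)"
      "represents s R1" "R1 (tmp 0) = reval a s" "R1 (tmp (Suc 0)) = reval b s"
    by (rule exec_pair)
  have "\<exists>t R'. exec (IfLe (tmp 0) (tmp 1) P Q) (R1, memory s) (Suc t) (R', memory s') \<and>
      t \<le> max T U \<and> represents s' R'"
  proof (cases "reval a s \<le> reval b s")
    case True
    from assms(1)[OF this] R1(2) obtain t R' where
      "exec P (R1, memory s) t (R', memory s')" "t \<le> T" "represents s' R'" by (rule realizesE)
    then show ?thesis using True R1(3,4) by (intro exI conjI exec.IfTrue) auto
  next
    case False
    from assms(2)[OF this] R1(2) obtain t R' where
      "exec Q (R1, memory s) t (R', memory s')" "t \<le> U" "represents s' R'" by (rule realizesE)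
    then show ?thesis using False R1(3,4) by (intro exI conjI exec.IfFalse) auto
  qed
  then obtain t R' where
    R': "exec (IfLe (tmp 0) (tmp (Suc 0)) P Q) (R1, memory s) (Suc t) (R', memory s')"
      "t \<le> max T U" "represents s' R'" by auto
  show "\<exists>t R'. exec (Seq (Seq (rcode a 0) (rcode b 1)) (IfLe (tmp 0) (tmp 1) P Q)) (R, memory s) t
      (R', memory s') \<and> t \<le> rcost a + rcost b + 1 + max T U \<and> represents s' R'"
    using exec.Seq[OF R1(1) R'(1)] R'(2,3) by (intro exI conjI) auto
qed

lemma realizes_compile: "well_formed c \<Longrightarrow> realizes (compile c) (cost (param s) c) s (run c s)"
proof (induction c arbitrary: s)
  case Nop
  then show ?case by (auto simp: realizes_def intro!: exI exec.Skip)
next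
  case (SetIndex x e)
  show ?case
    unfolding compile.simps cost.simps run.simps by (intro realizes_set_index computes_icode)
next
  case (SetScalar x e)
  show ?case
    unfolding compile.simps cost.simps run.simps
    by (rule realizes_assign[OF computes_rcode]) (auto simp: represents_def)
next
  case (SetArray a k e)
  have "realizes (store_code (icode (address a k) 0) (rcode e 1))
      (icost (address a k) + rcost e + 1) s (set_array a (ieval k s) (reval e s) s)"
    by (rule realizes_store[OF computes_icode computes_rcode])
      (simp_all add: memory_set_array ieval_address)
  then have "realizes (store_code (icode (address a k) 0) (rcode e 1))
      (icost k + rcost e + 8) s (set_array a (ieval k s) (reval e s) s)"
    by (rule realizes_mono) (simp add: address_def)
  then show ?case by simp
next
  case (Then c c')
  then show ?case using realizes_Seq by fastforce
next
  case (Cond a b c c')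
  then show ?case
    unfolding compile.simps cost.simps by (intro realizes_Cond) auto
next
  case (For x p c)
  show ?case by (rule realizes_For) (use For in simp_all)
qed

section \<open>Memory layout\<close>

lemma length_concat_matrix:
  "length (concat (map (\<lambda>i. map (h i) [0..<n]) [0..<m])) = m * n"
  by (induction m) auto

lemma matrix_index: "i < m \<Longrightarrow> j < n \<Longrightarrow> i * n + j < m * n" for i j m n :: nat
proof -
  assume "i < m" "j < n"
  then have "i * n + j < Suc i * n" by simp
  also have "\<dots> \<le> m * n" using \<open>i < m\<close> by (intro mult_right_mono) auto
  finally show ?thesis .
qed

lemma nth_concat_matrix:
  assumes "i < m" "j < n"
  shows "concat (map (\<lambda>i. map (h i) [0..<n]) [0..<m]) ! (i * n + j) = h i j"
  using assms
proof (induction m)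
  case (Suc m)
  then show ?case
    using matrix_index[of i m j n] by (cases "i = m") (auto simp: nth_append length_concat_matrix)
qed simp

primrec layout :: "sched_instance \<Rightarrow> nat \<Rightarrow> nat \<Rightarrow> param_name \<Rightarrow> nat" where
  "layout I fmax l NumJobs = njobs I"
| "layout I fmax l NumScens = nscens I"
| "layout I fmax l MaxCost = fmax"
| "layout I fmax l NumVectors = Suc fmax ^ nscens I"
| "layout I fmax l WeightBase = l + 3"
| "layout I fmax l PtimeBase = l + 3 + njobs I"
| "layout I fmax l DueBase = l + 3 + njobs I + nscens I * njobs I"
| "layout I fmax l ProbBase = l + 3 + njobs I + 2 * (nscens I * njobs I)"
| "layout I fmax l PrecBase = l + 3 + njobs I + 2 * (nscens I * njobs I) + nscens I"
| "layout I fmax l WorkBase =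
     l + 3 + njobs I + 2 * (nscens I * njobs I) + nscens I + njobs I * njobs I"

lemma length_encode: "length (encode ps I fmax) = layout I fmax (length ps) WorkBase"
  by (simp add: encode_def Let_def length_concat_matrix)

lemma encode_nth_param: "k < length ps \<Longrightarrow> encode ps I fmax ! k = ps ! k"
  by (simp add: encode_def Let_def nth_append)

lemma encode_nth_header:
  "encode ps I fmax ! length ps = real (njobs I)"
  "encode ps I fmax ! (length ps + 1) = real (nscens I)"
  "encode ps I fmax ! (length ps + 2) = real fmax"
  by (simp_all add: encode_def Let_def nth_append)

lemma encode_nth_weight:
  "j < njobs I \<Longrightarrow> encode ps I fmax ! (layout I fmax (length ps) WeightBase + j) = real (weight I j)"
  by (simp add: encode_def Let_def nth_append)

lemma encode_nth_ptime:
  assumes "i < nscens I" "j < njobs I"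
  shows "encode ps I fmax ! (layout I fmax (length ps) PtimeBase + (i * njobs I + j)) =
    real (ptime I i j)"
  using matrix_index[OF assms] assms
  by (simp add: encode_def Let_def nth_append length_concat_matrix nth_concat_matrix)

lemma encode_nth_due:
  assumes "i < nscens I" "j < njobs I"
  shows "encode ps I fmax ! (layout I fmax (length ps) DueBase + (i * njobs I + j)) =
    real (due I i j)"
  using matrix_index[OF assms] assms
  by (simp add: encode_def Let_def nth_append length_concat_matrix nth_concat_matrix)

lemma encode_nth_prob:
  "i < nscens I \<Longrightarrow> encode ps I fmax ! (layout I fmax (length ps) ProbBase + i) = pmf (scen_pmf I) i"
  by (simp add: encode_def Let_def nth_append length_concat_matrix)

lemma encode_nth_prec:
  assumes "i < njobs I" "j < njobs I"
  shows "encode ps I fmax ! (layout I fmax (length ps) PrecBase + (i * njobs I + j)) =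
    of_bool ((i, j) \<in> prec I)"
  using matrix_index[OF assms] assms
  by (simp add: encode_def Let_def nth_append length_concat_matrix nth_concat_matrix)

definition vector_at :: "param_name \<Rightarrow> iexp \<Rightarrow> rexp" where
  "vector_at p e = Cell (IAdd (IPar p) e)"

definition matrix_at :: "param_name \<Rightarrow> iexp \<Rightarrow> iexp \<Rightarrow> rexp" where
  "matrix_at p e e' = Cell (IAdd (IPar p) (IAdd (IMul e (IPar NumJobs)) e'))"

lemma reval_vector_at:
  "param s p + ieval e s < param s WorkBase \<Longrightarrow>
     reval (vector_at p e) s = input s (param s p + ieval e s)"
  by (simp add: vector_at_def memory_input)

lemma reval_matrix_at:
  assumes "param s p + param s r * param s NumJobs \<le> param s WorkBase"
    and "ieval e s < param s r" "ieval e' s < param s NumJobs"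
  shows "reval (matrix_at p e e') s =
    input s (param s p + (ieval e s * param s NumJobs + ieval e' s))"
  using assms matrix_index[OF assms(2,3)] by (simp add: matrix_at_def memory_input)

section \<open>Lawler's rule as a program\<close>

definition row_sum :: "array_name \<Rightarrow> param_name \<Rightarrow> cmd" where
  "row_sum a p =
     SetArray a (IVar Candidate) (num 0) ;;
     For Job NumJobs (SetArray a (IVar Candidate)
       (elem a (IVar Candidate) \<oplus> matrix_at p (IVar Candidate) (IVar Job)))"

definition row_sums :: "array_name \<Rightarrow> param_name \<Rightarrow> param_name \<Rightarrow> cmd" where
  "row_sums a r p = For Candidate r (row_sum a p)"

definition subtract_column :: "array_name \<Rightarrow> param_name \<Rightarrow> param_name \<Rightarrow> cmd" where
  "subtract_column a r p =
     For Candidate r (SetArray a (IVar Candidate)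
       (elem a (IVar Candidate) \<ominus> matrix_at p (IVar Candidate) (IVar Job)))"

definition release_jobs :: cmd where
  "release_jobs =
     For Job NumJobs (SetArray Unscheduled (IVar Job) (num 1)) ;;
     row_sums Successors NumJobs PrecBase ;;
     row_sums Workload NumScens PtimeBase"

definition remove_job :: cmd where
  "remove_job =
     SetArray Unscheduled (IVar Job) (num 0) ;;
     subtract_column Successors NumJobs PrecBase ;;
     subtract_column Workload NumScens PtimeBase"

text \<open>
  As the number of unscheduled successors is a natural number and the indicator is \<open>0\<close> or \<open>1\<close>, the
  initial violation is positive unless the candidate is unscheduled and has no such successor.
\<close>

definition test_candidate :: cmd where
  "test_candidate =
     SetScalar Violation
       (num 1 \<oplus> elem Successors (IVar Candidate) \<ominus> elem Unscheduled (IVar Candidate)) ;;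
     For Scenario NumScens
       (Cond (vector_at WeightBase (IVar Candidate) \<otimes> elem Workload (IVar Scenario))
          (elem Threshold (IVar Scenario) \<oplus> vector_at WeightBase (IVar Candidate) \<otimes>
             matrix_at DueBase (IVar Scenario) (IVar Candidate))
          Nop (SetScalar Violation (num 1)))"

text \<open>The number of jobs, which is not a job, signals that no job is admissible.\<close>

definition find_job :: cmd where
  "find_job =
     SetIndex Job (IPar NumJobs) ;;
     For Candidate NumJobs
       (test_candidate ;; Cond (SVar Violation) (num 0) (SetIndex Job (IVar Candidate)) Nop)"

definition place_job :: cmd where
  "place_job =
     find_job ;;
     Cond (OfIndex (IAdd (IVar Job) (INum 1))) (OfIndex (IPar NumJobs))
       (SetArray Chosen (IVar Position) (OfIndex (IVar Job)) ;; remove_job)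
       (SetScalar Feasible (num 0))"

definition greedy :: cmd where
  "greedy = release_jobs ;; SetScalar Feasible (num 1) ;; For Position NumJobs place_job"

lemma writes_greedy_parts [simp]:
  "writes (row_sum a p) = {Index Job, Array a}"
  "writes (row_sums a r p) = {Index Candidate, Index Job, Array a}"
  "writes (subtract_column a r p) = {Index Candidate, Array a}"
  "writes release_jobs =
    {Index Candidate, Index Job, Array Unscheduled, Array Successors, Array Workload}"
  "writes remove_job = {Index Candidate, Array Unscheduled, Array Successors, Array Workload}"
  "writes test_candidate = {Index Scenario, Scalar Violation}"
  "writes find_job = {Index Candidate, Index Job, Index Scenario, Scalar Violation}"
  by (auto simp: row_sum_def row_sums_def subtract_column_def release_jobs_def remove_job_def
      test_candidate_def find_job_def)

lemma writes_place_job [simp]: "writes place_job =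
    {Index Candidate, Index Job, Index Scenario, Scalar Violation, Scalar Feasible,
     Array Unscheduled, Array Successors, Array Workload, Array Chosen}"
  by (auto simp: place_job_def)

lemma writes_greedy [simp]: "writes greedy =
    {Index Candidate, Index Job, Index Scenario, Index Position, Scalar Violation, Scalar Feasible,
     Array Unscheduled, Array Successors, Array Workload, Array Chosen}"
  by (auto simp: greedy_def)

lemma array_row_sum:
  assumes "param s p + param s r * param s NumJobs \<le> param s WorkBase"
    "index s Candidate < param s r"
  shows "array (run (row_sum a p) s) a = (array s a)(index s Candidate :=
    \<Sum>j<param s NumJobs. input s (param s p + (index s Candidate * param s NumJobs + j)))"
  unfolding row_sum_def run_Then
  by (rule run_For_induct[where J = "\<lambda>l s'. array s' a = (array s a)(index s Candidate :=
      \<Sum>j<l. input s (param s p + (index s Candidate * param s NumJobs + j)))"])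
     (use assms in \<open>auto simp: unchanged_def reval_matrix_at[where r = r]\<close>)

lemma array_row_sums:
  assumes "param s p + param s r * param s NumJobs \<le> param s WorkBase" "i < param s r"
  shows "array (run (row_sums a r p) s) a i =
    (\<Sum>j<param s NumJobs. input s (param s p + (i * param s NumJobs + j)))"
  unfolding row_sums_def
  by (rule run_For_induct[where J = "\<lambda>k s'. \<forall>i<k. array s' a i =
      (\<Sum>j<param s NumJobs. input s (param s p + (i * param s NumJobs + j)))"])
     (use assms in \<open>auto simp: unchanged_def array_row_sum[where r = r] less_Suc_eq\<close>)

lemma array_subtract_column:
  assumes p: "param s p + param s r * param s NumJobs \<le> param s WorkBase"
    and j: "index s Job < param s NumJobs" and i: "i < param s r"
  shows "array (run (subtract_column a r p) s) a i =
    array s a i - input s (param s p + (i * param s NumJobs + index s Job))"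
  unfolding subtract_column_def
  by (rule run_For_induct[where J = "\<lambda>k s'. \<forall>i<param s r. array s' a i = array s a i -
      (if i < k then input s (param s p + (i * param s NumJobs + index s Job)) else 0)"])
     (use i j p in \<open>auto simp: unchanged_def reval_matrix_at[where r = r] less_Suc_eq\<close>)

locale encoded_instance = bounded_instance I fmax for I fmax +
  fixes ps :: "real list"
begin

definition loaded :: "state \<Rightarrow> bool" where
  "loaded s \<longleftrightarrow> param s = layout I fmax (length ps) \<and>
     (\<forall>a<layout I fmax (length ps) WorkBase. input s a = encode ps I fmax ! a)"

definition thresholds :: "(nat \<Rightarrow> nat) \<Rightarrow> state \<Rightarrow> bool" where
  "thresholds t s \<longleftrightarrow> (\<forall>i<K. array s Threshold i = real (t i))"

definition tracks :: "nat set \<Rightarrow> state \<Rightarrow> bool" where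
  "tracks V s \<longleftrightarrow>
     (\<forall>j<n. array s Unscheduled j = of_bool (j \<in> V)) \<and>
     (\<forall>j<n. array s Successors j = real (card (V \<inter> {k. (j, k) \<in> prec I}))) \<and>
     (\<forall>i<K. array s Workload i = real (load V i))"

lemma loaded_simps [simp]:
  "loaded (run c s) \<longleftrightarrow> loaded s"
  "loaded (set_index x k s) \<longleftrightarrow> loaded s"
  "loaded (set_scalar y r s) \<longleftrightarrow> loaded s"
  "loaded (set_array a k r s) \<longleftrightarrow> loaded s"
  by (simp_all add: loaded_def)

lemma loaded_unchanged: "unchanged X s s' \<Longrightarrow> loaded s \<Longrightarrow> loaded s'"
  by (simp add: loaded_def unchanged_def)

lemma loaded_sizes:
  assumes "loaded s"
  shows "param s NumJobs = n" "param s NumScens = K" "param s MaxCost = fmax"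
    "param s NumVectors = Suc fmax ^ K"
  using assms by (simp_all add: loaded_def)

lemma loaded_bounds:
  assumes "loaded s"
  shows "param s PtimeBase + K * n \<le> param s WorkBase" "param s DueBase + K * n \<le> param s WorkBase"
    "param s PrecBase + n * n \<le> param s WorkBase"
  using assms by (simp_all add: loaded_def)

lemma input_matrix:
  assumes "loaded s" "param s p + m * n \<le> param s WorkBase" "i < m" "j < n"
  shows "input s (param s p + (i * n + j)) =
    encode ps I fmax ! (layout I fmax (length ps) p + (i * n + j))"
proof -
  have "param s p + (i * n + j) < param s WorkBase"
    using assms(2) matrix_index[OF assms(3,4)] by linarith
  then show ?thesis using assms(1) by (simp add: loaded_def)
qed

lemma input_ptime:
  assumes "loaded s" "i < K" "j < n"
  shows "input s (param s PtimeBase + (i * n + j)) = real (ptime I i j)"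
  unfolding input_matrix[OF assms(1) loaded_bounds(1)[OF assms(1)] assms(2,3)]
  using assms(2,3) by (rule encode_nth_ptime)

lemma input_due:
  assumes "loaded s" "i < K" "j < n"
  shows "input s (param s DueBase + (i * n + j)) = real (due I i j)"
  unfolding input_matrix[OF assms(1) loaded_bounds(2)[OF assms(1)] assms(2,3)]
  using assms(2,3) by (rule encode_nth_due)

lemma input_prec:
  assumes "loaded s" "i < n" "j < n"
  shows "input s (param s PrecBase + (i * n + j)) = of_bool ((i, j) \<in> prec I)"
  unfolding input_matrix[OF assms(1) loaded_bounds(3)[OF assms(1)] assms(2,3)]
  using assms(2,3) by (rule encode_nth_prec)

lemma reval_weight:
  assumes "loaded s" "ieval e s < n"
  shows "reval (vector_at WeightBase e) s = real (weight I (ieval e s))"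
  using assms encode_nth_weight[OF assms(2), of ps fmax]
  by (simp add: loaded_def reval_vector_at)

lemma reval_prob:
  assumes "loaded s" "ieval e s < K"
  shows "reval (vector_at ProbBase e) s = q (ieval e s)"
  using assms encode_nth_prob[OF assms(2), of ps fmax]
  by (simp add: loaded_def reval_vector_at)

lemma reval_due:
  assumes "loaded s" "ieval e s < K" "ieval e' s < n"
  shows "reval (matrix_at DueBase e e') s = real (due I (ieval e s) (ieval e' s))"
  using assms
  by (subst reval_matrix_at[where r = NumScens]) (simp_all add: loaded_sizes loaded_bounds input_due)

lemma tracks_release_jobs:
  assumes "loaded s"
  shows "tracks {..<n} (run release_jobs s)"
proof -
  let ?s1 = "run (For Job NumJobs (SetArray Unscheduled (IVar Job) (num 1))) s"
  let ?s2 = "run (row_sums Successors NumJobs PrecBase) ?s1"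
  have "\<forall>j<n. array ?s1 Unscheduled j = 1"
    by (rule run_For_induct[where J = "\<lambda>k s'. \<forall>j<k. array s' Unscheduled j = 1"])
       (use assms in \<open>auto simp: loaded_sizes less_Suc_eq\<close>)
  moreover have "array ?s2 Successors j = real (card ({..<n} \<inter> {k. (j, k) \<in> prec I}))"
    if "j < n" for j
    using that assms by (subst array_row_sums) (simp_all add: loaded_sizes loaded_bounds input_prec)
  moreover have "array (run (row_sums Workload NumScens PtimeBase) ?s2) Workload i =
      real (load {..<n} i)"
    if "i < K" for i
    using that assms
    by (subst array_row_sums) (simp_all add: loaded_sizes loaded_bounds input_ptime load_def)
  ultimately show ?thesis by (simp add: tracks_def release_jobs_def)
qed

lemma tracks_remove_job:
  assumes s: "loaded s" "tracks V s" and V: "V \<subseteq> {..<n}" and j: "index s Job \<in> V"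
  shows "tracks (V - {index s Job}) (run remove_job s)"
proof -
  let ?j = "index s Job"
  let ?s1 = "run (SetArray Unscheduled (IVar Job) (num 0)) s"
  let ?s2 = "run (subtract_column Successors NumJobs PrecBase) ?s1"
  have fin: "finite V" using V finite_subset by blast
  have jn: "?j < n" using j V by auto
  have "\<forall>k<n. array ?s1 Unscheduled k = of_bool (k \<in> V - {?j})"
    using s(2) by (simp add: tracks_def)
  moreover have "array ?s2 Successors k = real (card ((V - {?j}) \<inter> {l. (k, l) \<in> prec I}))"
    if "k < n" for k
  proof -
    have "array ?s2 Successors k = (\<Sum>l\<in>V. of_bool ((k, l) \<in> prec I)) - of_bool ((k, ?j) \<in> prec I)"
      using that s jn fin
      by (subst array_subtract_column)
        (simp_all add: loaded_sizes loaded_bounds input_prec tracks_def)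
    also have "\<dots> = (\<Sum>l\<in>V - {?j}. of_bool ((k, l) \<in> prec I))"
      using fin j by (simp add: sum_diff1 del: sum_of_bool_eq)
    finally show ?thesis using fin by simp
  qed
  moreover have "array (run (subtract_column Workload NumScens PtimeBase) ?s2) Workload i =
      real (load (V - {?j}) i)"
    if "i < K" for i
    using that s jn fin j
    by (subst array_subtract_column)
       (simp_all add: loaded_sizes loaded_bounds input_ptime tracks_def sum_diff1 load_def)
  ultimately show ?thesis by (simp add: tracks_def remove_job_def)
qed

lemma run_test_candidate:
  assumes s: "loaded s" "tracks V s" "thresholds t s" and V: "V \<subseteq> {..<n}"
    and j: "index s Candidate < n"
  shows "scalar (run test_candidate s) Violation \<le> 0 \<longleftrightarrow>
    index s Candidate \<in> V \<and> admissible t V (index s Candidate)"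
proof -
  let ?j = "index s Candidate"
  let ?released = "?j \<in> V \<and> (\<forall>k\<in>V. (?j, k) \<notin> prec I)"
  let ?fits = "\<lambda>i. weight I ?j * load V i \<le> t i + weight I ?j * due I i ?j"
  have "finite V" using V finite_subset by blast
  then have "card (V \<inter> {k. (?j, k) \<in> prec I}) = 0 \<longleftrightarrow> (\<forall>k\<in>V. (?j, k) \<notin> prec I)" by auto
  then have released_iff: "1 + array s Successors ?j - array s Unscheduled ?j \<le> 0 \<longleftrightarrow> ?released"
    using s(2) j by (auto simp: tracks_def)
  show ?thesis
    unfolding test_candidate_def run_Then
  proof (rule run_For_induct[where
      J = "\<lambda>k s'. scalar s' Violation \<le> 0 \<longleftrightarrow> ?released \<and> (\<forall>i<k. ?fits i)"],
      goal_cases init step final)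
    case init
    then show ?case using released_iff by simp
  next
    case (step i s')
    have i: "i < K" using step(1) s(1) by (simp add: loaded_sizes)
    have s': "loaded s'" using loaded_unchanged[OF step(2)] s(1) by simp
    have "index s' Candidate = ?j" "array s' = array s" using step(2) by (auto simp: unchanged_def)
    then have "reval (vector_at WeightBase (IVar Candidate) \<otimes> elem Workload (IVar Scenario))
        (set_index Scenario i s') = real (weight I ?j * load V i)"
      "reval (elem Threshold (IVar Scenario) \<oplus> vector_at WeightBase (IVar Candidate) \<otimes>
        matrix_at DueBase (IVar Scenario) (IVar Candidate)) (set_index Scenario i s') =
        real (t i + weight I ?j * due I i ?j)"
      using s' i j s(2,3) by (simp_all add: reval_weight reval_due tracks_def thresholds_def)
    then show ?case
      using step(3) by (auto simp: less_Suc_eq simp del: reval_Op of_nat_mult of_nat_add)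
  next
    case (final s')
    then show ?case using s(1) by (auto simp: admissible_def loaded_sizes)
  qed
qed

definition selects :: "(nat \<Rightarrow> nat) \<Rightarrow> nat set \<Rightarrow> nat \<Rightarrow> bool" where
  "selects t V x \<longleftrightarrow>
     (x \<in> V \<and> admissible t V x) \<or> (x = n \<and> (\<forall>y\<in>V. \<not> admissible t V y))"

lemma selects_find_job:
  assumes s: "loaded s" "tracks V s" "thresholds t s" and V: "V \<subseteq> {..<n}"
  shows "selects t V (index (run find_job s) Job)"
  unfolding find_job_def run_Then
proof (rule run_For_induct[where J = "\<lambda>k s'. (index s' Job \<in> V \<and> admissible t V (index s' Job)) \<or>
    (index s' Job = n \<and> (\<forall>x\<in>V. x < k \<longrightarrow> \<not> admissible t V x))"], goal_cases init step final)
  case init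
  then show ?case using s(1) by (simp add: loaded_sizes)
next
  case (step k s')
  let ?s = "set_index Candidate k s'"
  have "k < n" using step(1) s(1) by (simp add: loaded_sizes)
  moreover have "loaded ?s" using loaded_unchanged[OF step(2)] s(1) by simp
  moreover have "tracks V ?s" "thresholds t ?s"
    using step(2) s(2,3) by (auto simp: unchanged_def tracks_def thresholds_def)
  ultimately have "scalar (run test_candidate ?s) Violation \<le> 0 \<longleftrightarrow> k \<in> V \<and> admissible t V k"
    using run_test_candidate[of ?s V t] V by simp
  then show ?case using step(3) by (auto simp: less_Suc_eq)
next
  case (final s')
  then show ?case using s(1) V by (auto simp: selects_def loaded_sizes)
qed

definition greedy_invariant :: "(nat \<Rightarrow> nat) \<Rightarrow> nat \<Rightarrow> state \<Rightarrow> bool" where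
  "greedy_invariant t k s \<longleftrightarrow>
     scalar s Feasible = 1 \<and> (\<exists>xs. greedy_tail t xs \<and> length xs = k \<and> tracks ({..<n} - set xs) s \<and>
       (\<forall>p<k. array s Chosen p = real (rev xs ! p))) \<or>
     scalar s Feasible = 0 \<and> (\<forall>\<pi>. \<not> meets t \<pi>)"

lemma greedy_invariant_place_job:
  assumes s: "loaded s" "thresholds t s" and k: "index s Position = k" "k < n"
    and inv: "greedy_invariant t k s"
  shows "greedy_invariant t (Suc k) (run place_job s)"
proof (cases "scalar s Feasible = 0")
  case True
  then show ?thesis using inv unfolding greedy_invariant_def by (auto simp: place_job_def)
next
  case False
  then obtain xs where feasible: "scalar s Feasible = 1" and xs: "greedy_tail t xs" "length xs = k"
    and tracks: "tracks ({..<n} - set xs) s"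
    and chosen: "\<forall>p<k. array s Chosen p = real (rev xs ! p)"
    using inv by (auto simp: greedy_invariant_def)
  let ?V = "{..<n} - set xs" and ?s = "run find_job s"
  let ?x = "index ?s Job"
  consider (found) "?x \<in> ?V" "admissible t ?V ?x" | (stuck) "?x = n" "\<forall>x\<in>?V. \<not> admissible t ?V x"
    using selects_find_job[OF s(1) tracks s(2)] by (auto simp: selects_def)
  then show ?thesis
  proof cases
    case found
    let ?s' = "run (SetArray Chosen (IVar Position) (OfIndex (IVar Job))) ?s"
    have place: "run place_job s = run remove_job ?s'"
      using found(1) s(1) by (simp add: place_job_def loaded_sizes)
    have "tracks ?V ?s'" using tracks by (simp add: tracks_def)
    then have "tracks (?V - {?x}) (run remove_job ?s')"
      using tracks_remove_job[of ?s' ?V] s(1) found(1) by simp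
    moreover have "?V - {?x} = {..<n} - set (?x # xs)" by auto
    moreover have "\<forall>p<Suc k. array (run remove_job ?s') Chosen p = real (rev (?x # xs) ! p)"
      using chosen xs(2) k(1) by (auto simp: nth_append less_Suc_eq)
    moreover have "greedy_tail t (?x # xs)" "length (?x # xs) = Suc k" using found xs by simp_all
    ultimately show ?thesis
      unfolding greedy_invariant_def place using feasible
      by (intro disjI1 conjI exI[of _ "?x # xs"]) simp_all
  next
    case stuck
    then show ?thesis
      using not_meets_if_stuck[of xs t] xs(2) k(2) s(1)
      by (simp add: greedy_invariant_def place_job_def loaded_sizes)
  qed
qed

definition decides :: "(nat \<Rightarrow> nat) \<Rightarrow> state \<Rightarrow> bool" where
  "decides t s \<longleftrightarrow>
     scalar s Feasible = 1 \<and> (\<exists>\<pi>. meets t \<pi> \<and> (\<forall>p<n. array s Chosen p = real (rev \<pi> ! p))) \<or>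
     scalar s Feasible = 0 \<and> (\<forall>\<pi>. \<not> meets t \<pi>)"

lemma decides_greedy:
  assumes s: "loaded s" "thresholds t s"
  shows "decides t (run greedy s)"
  unfolding greedy_def run_Then
proof (rule run_For_induct[where J = "greedy_invariant t"], goal_cases init step final)
  case init
  have "tracks {..<n} (run release_jobs s)" using s(1) by (rule tracks_release_jobs)
  then show ?case by (auto simp: greedy_invariant_def tracks_def intro!: exI[of _ "[]"])
next
  case (step k s')
  let ?s = "set_index Position k s'"
  have "loaded ?s" using loaded_unchanged[OF step(2)] s(1) by simp
  moreover have "thresholds t ?s" using step(2) s(2) by (auto simp: unchanged_def thresholds_def)
  moreover have "k < n" using step(1) s(1) by (simp add: loaded_sizes)
  moreover have "greedy_invariant t k ?s"
    using step(3) by (simp add: greedy_invariant_def tracks_def)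
  ultimately show ?case using greedy_invariant_place_job[of ?s t k] by simp
next
  case (final s')
  then show ?case
    using s(1) meets_if_greedy_tail by (auto simp: greedy_invariant_def decides_def loaded_sizes)
qed

end

section \<open>Enumeration of threshold vectors\<close>

definition digit :: "nat \<Rightarrow> nat \<Rightarrow> nat \<Rightarrow> nat" where
  "digit F m i = m div F ^ i mod F"

lemma digit_0 [simp]: "digit F 0 i = 0"
  by (simp add: digit_def)

lemma digit_Suc:
  "digit F (Suc m) k = (if F ^ k dvd Suc m then Suc (digit F m k) mod F else digit F m k)"
  by (auto simp: digit_def div_Suc mod_Suc_eq)

lemma power_Suc_dvd_Suc_iff:
  assumes "0 < F"
  shows "F ^ Suc k dvd Suc m \<longleftrightarrow> F ^ k dvd Suc m \<and> Suc (digit F m k) = F"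
proof (cases "F ^ k dvd Suc m")
  case True
  then have "F ^ Suc k dvd Suc m \<longleftrightarrow> F dvd Suc m div F ^ k"
    using assms
    by (metis dvd_mult_div_cancel dvd_times_left_cancel_iff power_Suc2 power_not_zero neq0_conv)
  also have "Suc m div F ^ k = Suc (m div F ^ k)"
    using True by (simp add: div_Suc)
  also have "F dvd Suc (m div F ^ k) \<longleftrightarrow> Suc (digit F m k) = F"
    using assms by (simp add: mod_Suc digit_def flip: mod_eq_0_iff_dvd)
  finally show ?thesis using True by simp
next
  case False
  then show ?thesis using power_le_dvd[of F "Suc k" "Suc m" k] by auto
qed

lemma digit_eq_0: "m < F ^ i \<Longrightarrow> digit F m i = 0"
  by (simp add: digit_def)

lemma digit_add_mult_power:
  assumes "0 < F" "i < k"
  shows "digit F (m + c * F ^ k) i = digit F m i"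
proof -
  obtain e where e: "k = i + Suc e" using assms(2) less_imp_Suc_add[of i k] by auto
  have "(m + c * F ^ k) div F ^ i = (m + F ^ i * (F * (c * F ^ e))) div F ^ i"
    by (simp add: e power_add ac_simps)
  also have "\<dots> = F * (c * F ^ e) + m div F ^ i"
    using assms(1) by (intro div_mult_self2) simp
  finally show ?thesis by (simp add: digit_def)
qed

lemma ex_digit_eq:
  assumes "0 < F" "t \<in> PiE_dflt {..<k} 0 (\<lambda>_. {..<F})"
  shows "\<exists>m<F ^ k. digit F m = t"
  using assms(2)
proof (induction k arbitrary: t)
  case 0
  then show ?case by (auto simp: PiE_dflt_def digit_def)
next
  case (Suc k)
  let ?t = "t(k := 0)"
  have "?t \<in> PiE_dflt {..<k} 0 (\<lambda>_. {..<F})" "t k < F"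
    using Suc.prems by (auto simp: PiE_dflt_def less_Suc_eq)
  with Suc.IH obtain m where m: "m < F ^ k" "digit F m = ?t" by blast
  let ?m = "m + t k * F ^ k"
  have "?m < Suc (t k) * F ^ k" using m(1) by simp
  also have "\<dots> \<le> F ^ Suc k" using \<open>t k < F\<close> by (simp add: mult_le_mono1 Suc_leI del: mult_Suc)
  finally have less: "?m < F ^ Suc k" .
  have "digit F ?m i = t i" for i
  proof -
    consider (lower) "i < k" | (top) "i = k" | (beyond) "k < i" by linarith
    then show ?thesis
    proof cases
      case lower
      then show ?thesis using m(2) digit_add_mult_power[OF assms(1) lower, of m "t k"] by simp
    next
      case top
      then show ?thesis using m(1) \<open>t k < F\<close> by (simp add: digit_def)
    next
      case beyond
      then have "?m < F ^ i" using less power_increasing[of "Suc k" i F] assms(1) by simp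
      then show ?thesis using Suc.prems beyond by (simp add: digit_eq_0 PiE_dflt_def)
    qed
  qed
  with less show ?case by blast
qed

definition next_vector :: cmd where
  "next_vector =
     SetScalar Carry (num 1) ;;
     For Scenario NumScens
       (SetScalar Digit (elem Threshold (IVar Scenario) \<oplus> SVar Carry) ;;
        Cond (SVar Digit) (OfIndex (IPar MaxCost))
          (SetArray Threshold (IVar Scenario) (SVar Digit) ;; SetScalar Carry (num 0))
          (SetArray Threshold (IVar Scenario) (num 0) ;; SetScalar Carry (num 1)))"

definition find_minimum :: cmd where
  "find_minimum =
     SetScalar Minimum (OfIndex (IPar MaxCost)) ;;
     For Scenario NumScens
       (Cond (elem Threshold (IVar Scenario)) (SVar Minimum)
          (SetScalar Minimum (elem Threshold (IVar Scenario))) Nop)"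

definition CVaR_program :: "rexp \<Rightarrow> cmd" where
  "CVaR_program a =
     find_minimum ;;
     SetScalar Total (num 0) ;;
     For Scenario NumScens (SetScalar Total
       (SVar Total \<oplus> vector_at ProbBase (IVar Scenario) \<otimes> elem Threshold (IVar Scenario))) ;;
     SetScalar Value (SVar Total \<ominus> a \<otimes> SVar Minimum)"

definition VaR_program :: "rexp \<Rightarrow> cmd" where
  "VaR_program a =
     find_minimum ;;
     SetScalar Total (num 0) ;;
     For Scenario NumScens
       (Cond (elem Threshold (IVar Scenario)) (SVar Minimum)
          (SetScalar Total (SVar Total \<oplus> vector_at ProbBase (IVar Scenario))) Nop) ;;
     Cond a (SVar Total)
       (SetScalar Value (SVar Minimum))
       (SetScalar Value (OfIndex (IPar MaxCost)))"

definition record_best :: cmd where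
  "record_best =
     Cond (num 1) (SVar Feasible)
       (Cond (SVar Value) (SVar BestValue)
          (For Position NumJobs (SetArray Best (IVar Position) (elem Chosen (IVar Position))) ;;
           SetScalar BestValue (SVar Value))
          Nop)
       Nop"

definition try_vector :: "cmd \<Rightarrow> cmd" where
  "try_vector P = P ;; greedy ;; record_best ;; next_vector"

definition search :: "cmd \<Rightarrow> cmd" where
  "search P =
     SetScalar BestValue (OfIndex (IAdd (IPar MaxCost) (INum 1))) ;;
     For Vector NumVectors (try_vector P)"

definition value_program :: "cmd \<Rightarrow> bool" where
  "value_program P \<longleftrightarrow> well_formed P \<and>
     writes P \<subseteq> {Index Scenario, Scalar Minimum, Scalar Total, Scalar Value} \<and>
     (\<forall>\<rho>. cost \<rho> P \<le> 200 * (\<rho> NumScens + 1))"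

lemma writes_search_parts [simp]:
  "writes next_vector = {Index Scenario, Scalar Carry, Scalar Digit, Array Threshold}"
  "writes find_minimum = {Index Scenario, Scalar Minimum}"
  "writes record_best = {Index Position, Scalar BestValue, Array Best}"
  by (auto simp: next_vector_def find_minimum_def record_best_def)

lemma value_program_CVaR_VaR:
  assumes "rcost a \<le> 2"
  shows "value_program (CVaR_program a)" "value_program (VaR_program a)"
  using assms
  by (auto simp: value_program_def CVaR_program_def VaR_program_def find_minimum_def vector_at_def
      elem_def address_def)

context encoded_instance begin

abbreviation "dig \<equiv> digit (Suc fmax)"

lemma dig_in_vectors: "m < Suc fmax ^ K \<Longrightarrow> dig m \<in> vectors"
proof -
  assume m: "m < Suc fmax ^ K"
  have "dig m i = 0" if "K \<le> i" for i
    using m power_increasing[OF that, of "Suc fmax"] by (intro digit_eq_0) simp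
  moreover have "dig m i \<le> fmax" for i by (simp add: digit_def less_Suc_eq_le[symmetric])
  ultimately show ?thesis by (simp add: vectors_iff)
qed

lemma ex_dig_eq: "t \<in> vectors \<Longrightarrow> \<exists>m<Suc fmax ^ K. dig m = t"
  using ex_digit_eq[of "Suc fmax" t K] by (simp add: vectors_def lessThan_Suc_atMost)

lemma thresholds_next_vector:
  assumes s: "loaded s" "thresholds (dig m) s"
  shows "thresholds (dig (Suc m)) (run next_vector s)"
  unfolding next_vector_def run_Then
proof (rule run_For_induct[where J = "\<lambda>k s'.
    thresholds (\<lambda>i. dig (if i < k then Suc m else m) i) s' \<and>
    scalar s' Carry = of_bool (Suc fmax ^ k dvd Suc m)"], goal_cases init step final)
  case init
  then show ?case using s(2) by (simp add: thresholds_def)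
next
  case (step k s')
  have "k < K" using step(1) s(1) by (simp add: loaded_sizes)
  moreover have "param s' MaxCost = fmax"
    using loaded_unchanged[OF step(2)] s(1) by (simp add: loaded_sizes)
  moreover define d where "d = dig m k + of_bool (Suc fmax ^ k dvd Suc m)"
  moreover have "dig m k \<le> fmax" by (simp add: digit_def less_Suc_eq_le[symmetric])
  then have "dig (Suc m) k = (if d \<le> fmax then d else 0)" "Suc fmax ^ Suc k dvd Suc m \<longleftrightarrow> \<not> d \<le> fmax"
    unfolding digit_Suc power_Suc_dvd_Suc_iff[OF zero_less_Suc] d_def
    by (auto simp: mod_Suc)
  moreover have "array s' Threshold k + scalar s' Carry = real d"
    using step(3) \<open>k < K\<close> by (simp add: thresholds_def d_def)
  ultimately show ?case
    using step(3) by (auto simp: thresholds_def less_Suc_eq simp del: power_Suc)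
next
  case (final s')
  then show ?case using s(1) by (simp add: thresholds_def loaded_sizes)
qed

lemma run_find_minimum:
  assumes s: "loaded s" "thresholds t s" and t: "t \<in> vectors"
  shows "scalar (run find_minimum s) Minimum = real (minimum t)"
  unfolding find_minimum_def run_Then
proof (rule run_For_induct[where
    J = "\<lambda>k s'. scalar s' Minimum = real (Min (insert fmax (t ` {..<k})))"],
    goal_cases init step final)
  case init
  then show ?case using s(1) by (simp add: loaded_sizes)
next
  case (step k s')
  have "array s' = array s" using step(2) by (auto simp: unchanged_def)
  moreover have "k < K" using step(1) s(1) by (simp add: loaded_sizes)
  moreover have "Min (insert fmax (t ` {..<Suc k})) = min (t k) (Min (insert fmax (t ` {..<k})))"
    by (simp add: lessThan_Suc insert_commute[of fmax])
  ultimately show ?case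
    using step(3) s(2) by (auto simp: thresholds_def min_def simp del: Min_insert)
next
  case (final s')
  have "Min (insert fmax (t ` {..<K})) = min fmax (minimum t)"
    unfolding minimum_def using K_pos by (subst Min_insert) (auto simp: lessThan_empty_iff)
  moreover have "minimum t \<le> fmax" using t by (rule minimum_le_fmax)
  ultimately show ?case using final s(1) by (simp add: loaded_sizes min_def)
qed

definition denotes :: "rexp \<Rightarrow> real \<Rightarrow> bool" where
  "denotes a \<alpha> \<longleftrightarrow> (\<forall>s. loaded s \<longrightarrow> reval a s = \<alpha>)"

definition evaluates :: "cmd \<Rightarrow> ((nat \<Rightarrow> nat) \<Rightarrow> real) \<Rightarrow> bool" where
  "evaluates P val \<longleftrightarrow> (\<forall>s. \<forall>t\<in>vectors. loaded s \<longrightarrow> thresholds t s \<longrightarrow> scalar (run P s) Value = val t)"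

lemma evaluates_CVaR_program:
  assumes "denotes a \<alpha>"
  shows "evaluates (CVaR_program a) (CVaR_value \<alpha>)"
  unfolding evaluates_def
proof (intro allI ballI impI)
  fix s t assume t: "t \<in> vectors" and s: "loaded s" "thresholds t s"
  let ?s = "run (SetScalar Total (num 0)) (run find_minimum s)"
  let ?s' = "run (For Scenario NumScens (SetScalar Total
       (SVar Total \<oplus> vector_at ProbBase (IVar Scenario) \<otimes> elem Threshold (IVar Scenario)))) ?s"
  have "scalar ?s' Total = (\<Sum>i<K. q i * real (t i))"
  proof (rule run_For_induct[where J = "\<lambda>k s'. scalar s' Total = (\<Sum>i<k. q i * real (t i))"],
      goal_cases init step final)
    case (step k s')
    have "loaded s'" using loaded_unchanged[OF step(2)] s(1) by simp
    moreover have "array s' = array s" using step(2) by (auto simp: unchanged_def)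
    moreover have "k < K" using step(1) s(1) by (simp add: loaded_sizes)
    ultimately show ?case using step(3) s(2) by (simp add: reval_prob thresholds_def)
  qed (use s(1) in \<open>auto simp: loaded_sizes\<close>)
  moreover have "scalar ?s' Minimum = real (minimum t)" using run_find_minimum[OF s t] by simp
  moreover have "reval a ?s' = \<alpha>" using assms s(1) by (simp add: denotes_def)
  ultimately show "scalar (run (CVaR_program a) s) Value = CVaR_value \<alpha> t"
    by (simp add: CVaR_program_def CVaR_value_def)
qed

lemma evaluates_VaR_program:
  assumes "denotes a \<alpha>"
  shows "evaluates (VaR_program a) (VaR_value \<alpha>)"
  unfolding evaluates_def
proof (intro allI ballI impI)
  fix s t assume t: "t \<in> vectors" and s: "loaded s" "thresholds t s"
  let ?s = "run (SetScalar Total (num 0)) (run find_minimum s)"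
  let ?s' = "run (For Scenario NumScens
       (Cond (elem Threshold (IVar Scenario)) (SVar Minimum)
          (SetScalar Total (SVar Total \<oplus> vector_at ProbBase (IVar Scenario))) Nop)) ?s"
  have min: "scalar ?s Minimum = real (minimum t)" using run_find_minimum[OF s t] by simp
  have "scalar ?s' Total = (\<Sum>i<K. if t i \<le> minimum t then q i else 0)"
  proof (rule run_For_induct[where
      J = "\<lambda>k s'. scalar s' Total = (\<Sum>i<k. if t i \<le> minimum t then q i else 0)"],
      goal_cases init step final)
    case (step k s')
    have "loaded s'" using loaded_unchanged[OF step(2)] s(1) by simp
    moreover have "array s' = array s" "scalar s' Minimum = real (minimum t)"
      using step(2) min by (auto simp: unchanged_def)
    moreover have "k < K" using step(1) s(1) by (simp add: loaded_sizes)
    ultimately show ?case using step(3) s(2) by (simp add: reval_prob thresholds_def)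
  qed (use s(1) in \<open>auto simp: loaded_sizes\<close>)
  moreover have "scalar ?s' Minimum = real (minimum t)" using min by simp
  moreover have "reval a ?s' = \<alpha>" "param ?s' MaxCost = fmax"
    using assms s(1) by (simp_all add: denotes_def loaded_sizes)
  ultimately show "scalar (run (VaR_program a) s) Value = VaR_value \<alpha> t"
    by (simp add: VaR_program_def VaR_value_def)
qed

section \<open>Search for the best vector\<close>

text \<open>Before any schedule is found, \<open>fmax + 1\<close> stands for an infinite best value.\<close>

definition best_upto :: "((nat \<Rightarrow> nat) \<Rightarrow> real) \<Rightarrow> nat \<Rightarrow> state \<Rightarrow> bool" where
  "best_upto val m s \<longleftrightarrow>
     (\<forall>l<m. \<forall>\<pi>. meets (dig l) \<pi> \<longrightarrow> scalar s BestValue \<le> val (dig l)) \<and>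
     (scalar s BestValue = real fmax + 1 \<or>
      (\<exists>t \<pi>. meets t \<pi> \<and> scalar s BestValue = val t \<and> (\<forall>p<n. array s Best p = real (rev \<pi> ! p))))"

lemma best_upto_record_best:
  assumes s: "loaded s" "decides (dig m) s" "scalar s Value = val (dig m)"
    and best: "best_upto val m s"
  shows "best_upto val (Suc m) (run record_best s)"
proof (cases "scalar s Feasible = 1 \<and> scalar s Value \<le> scalar s BestValue")
  case True
  let ?copy = "For Position NumJobs (SetArray Best (IVar Position) (elem Chosen (IVar Position)))"
  have run: "run record_best s = run (SetScalar BestValue (SVar Value)) (run ?copy s)"
    using True by (simp add: record_best_def)
  have "\<forall>p<n. array (run ?copy s) Best p = array s Chosen p"
    by (rule run_For_induct[where J = "\<lambda>k s'. \<forall>p<k. array s' Best p = array s Chosen p"])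
       (use s(1) in \<open>auto simp: loaded_sizes unchanged_def less_Suc_eq\<close>)
  moreover obtain \<pi> where "meets (dig m) \<pi>" "\<forall>p<n. array s Chosen p = real (rev \<pi> ! p)"
    using True s(2) by (auto simp: decides_def)
  moreover have "val (dig m) \<le> val (dig l)" if "l < Suc m" "meets (dig l) \<pi>'" for l \<pi>'
    using that True best s(3) unfolding best_upto_def by (metis less_antisym order_refl order_trans)
  ultimately show ?thesis unfolding best_upto_def run using s(3) by auto
next
  case False
  then have "run record_best s = s" using s(2) by (auto simp: record_best_def decides_def)
  moreover have "scalar s BestValue \<le> val (dig m)" if "meets (dig m) \<pi>" for \<pi>
    using False that s(2,3) by (auto simp: decides_def)
  ultimately show ?thesis using best unfolding best_upto_def by (auto simp: less_Suc_eq)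
qed

lemma best_upto_try_vector:
  assumes P: "value_program P" "evaluates P val" and s: "loaded s" "thresholds (dig m) s"
    and m: "m < Suc fmax ^ K" and best: "best_upto val m s"
  shows "thresholds (dig (Suc m)) (run (try_vector P) s)"
    "best_upto val (Suc m) (run (try_vector P) s)"
proof -
  let ?s1 = "run P s"
  let ?s2 = "run greedy ?s1"
  let ?s3 = "run record_best ?s2"
  have P': "Array Threshold \<notin> writes P" "Array Best \<notin> writes P" "Scalar BestValue \<notin> writes P"
    using P(1) by (auto simp: value_program_def)
  have "scalar ?s1 Value = val (dig m)"
    using P(2) s dig_in_vectors[OF m] by (simp add: evaluates_def)
  moreover have "thresholds (dig m) ?s1" using s(2) P' by (simp add: thresholds_def)
  then have "decides (dig m) ?s2" using s(1) by (intro decides_greedy) simp_all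
  moreover have "best_upto val m ?s2" using best P' by (simp add: best_upto_def)
  ultimately have "best_upto val (Suc m) ?s3" using s(1) by (intro best_upto_record_best) simp_all
  then show "best_upto val (Suc m) (run (try_vector P) s)"
    by (simp add: try_vector_def best_upto_def)
  have "thresholds (dig m) ?s3" using s(2) P' by (simp add: thresholds_def)
  then show "thresholds (dig (Suc m)) (run (try_vector P) s)"
    using thresholds_next_vector[of ?s3] s(1) by (simp add: try_vector_def)
qed

lemma best_upto_search:
  assumes P: "value_program P" "evaluates P val" and s: "loaded s" "thresholds (\<lambda>_. 0) s"
  shows "best_upto val (Suc fmax ^ K) (run (search P) s)"
  unfolding search_def run_Then
proof (rule run_For_induct[where J = "\<lambda>m s'. thresholds (dig m) s' \<and> best_upto val m s'"],
    goal_cases init step final)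
  case init
  then show ?case using s by (simp add: thresholds_def best_upto_def loaded_sizes)
next
  case (step m s')
  let ?s = "set_index Vector m s'"
  have "m < Suc fmax ^ K" using step(1) s(1) by (simp add: loaded_sizes)
  moreover have "loaded ?s" using loaded_unchanged[OF step(2)] s(1) by simp
  moreover have "thresholds (dig m) ?s" "best_upto val m ?s"
    using step(3) by (simp_all add: thresholds_def best_upto_def)
  ultimately show ?case using best_upto_try_vector[OF P] by blast
next
  case (final s')
  then show ?case using s(1) by (simp add: best_upto_def loaded_sizes)
qed

lemma optimal_if_best_upto:
  assumes exact: "exact_value obj val" and best: "best_upto val (Suc fmax ^ K) s"
  shows "\<exists>\<pi>. is_arg_min (obj I) (schedule I) \<pi> \<and> (\<forall>p<n. array s Best p = real (rev \<pi> ! p))"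
proof -
  let ?x = "scalar s BestValue"
  obtain \<kappa> where \<kappa>: "0 < \<kappa>" "\<And>t \<pi>. meets t \<pi> \<Longrightarrow> \<kappa> * obj I \<pi> \<le> val t"
    "\<And>\<pi>. schedule I \<pi> \<Longrightarrow> \<exists>t\<in>vectors. meets t \<pi> \<and> val t \<le> \<kappa> * obj I \<pi>"
    using exact by (auto simp: exact_value_def)
  have val_le: "val t \<le> real fmax" if "t \<in> vectors" for t
    using exact that by (simp add: exact_value_def)
  have le: "?x \<le> val t" if "t \<in> vectors" "meets t \<pi>" for t \<pi>
    using best ex_dig_eq[OF that(1)] that(2) by (auto simp: best_upto_def)
  obtain t0 \<pi>0 where "t0 \<in> vectors" "meets t0 \<pi>0" using ex_schedule \<kappa>(3) by blast
  then have "?x \<noteq> real fmax + 1" using le[of t0] val_le[of t0] by fastforce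
  then obtain t \<pi> where \<pi>: "meets t \<pi>" "?x = val t" "\<forall>p<n. array s Best p = real (rev \<pi> ! p)"
    using best by (auto simp: best_upto_def)
  have "obj I \<pi> \<le> obj I \<pi>'" if sch: "schedule I \<pi>'" for \<pi>'
  proof -
    obtain t' where t': "t' \<in> vectors" "meets t' \<pi>'" "val t' \<le> \<kappa> * obj I \<pi>'"
      using \<kappa>(3)[OF sch] by blast
    have "\<kappa> * obj I \<pi> \<le> \<kappa> * obj I \<pi>'" using \<kappa>(2)[OF \<pi>(1)] \<pi>(2) le[OF t'(1,2)] t'(3) by linarith
    then show ?thesis using \<kappa>(1) by simp
  qed
  then have "is_arg_min (obj I) (schedule I) \<pi>"
    using \<pi>(1) by (auto simp: is_arg_min_linorder meets_def)
  then show ?thesis using \<pi>(3) by blast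
qed

end

section \<open>The solver\<close>

primrec assign_params :: "(param_name \<times> rexp) list \<Rightarrow> ram" where
  "assign_params [] = Skip"
| "assign_params (pe # pes) = Seq (assign (Param (fst pe)) (rcode (snd pe) 0)) (assign_params pes)"

definition layout_params :: "nat \<Rightarrow> (param_name \<times> rexp) list" where
  "layout_params l =
    [(NumJobs, Cell (INum l)),
     (NumScens, Cell (INum (l + 1))),
     (MaxCost, Cell (INum (l + 2))),
     (WeightBase, num (l + 3)),
     (PtimeBase, OfIndex (IAdd (IPar WeightBase) (IPar NumJobs))),
     (DueBase, OfIndex (IAdd (IPar PtimeBase) (IMul (IPar NumScens) (IPar NumJobs)))),
     (ProbBase, OfIndex (IAdd (IPar DueBase) (IMul (IPar NumScens) (IPar NumJobs)))),
     (PrecBase, OfIndex (IAdd (IPar ProbBase) (IPar NumScens))),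
     (WorkBase, OfIndex (IAdd (IPar PrecBase) (IMul (IPar NumJobs) (IPar NumJobs))))]"

definition count_vectors :: ram where
  "count_vectors = Seq (assign (Param NumVectors) (rcode (num 1) 0))
     (for_code Scenario NumScens (assign (Param NumVectors)
       (rcode (OfIndex (IMul (IPar NumVectors) (IAdd (IPar MaxCost) (INum 1)))) 0)))"

text \<open>\<^const>\<open>Best\<close> lists the jobs from the last to the first.\<close>

definition write_schedule :: ram where
  "write_schedule = for_code Position NumJobs (store_code
     (rcode (OfIndex (IPar NumJobs) \<ominus> OfIndex (IAdd (IVar Position) (INum 1))) 0)
     (rcode (elem Best (IVar Position)) 1))"

definition solver :: "nat \<Rightarrow> cmd \<Rightarrow> ram" where
  "solver l P = Seq (Seq (assign_params (layout_params l)) count_vectors)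
     (Seq (compile (search P)) write_schedule)"

definition state_of :: "(param_name \<Rightarrow> nat) \<Rightarrow> (nat \<Rightarrow> real) \<Rightarrow> state" where
  "state_of \<rho> M = \<lparr>param = \<rho>, input = M, index = \<lambda>_. 0, scalar = \<lambda>_. 0,
     array = \<lambda>a k. M (\<rho> WorkBase + (6 * k + slot a))\<rparr>"

lemma state_of_sel [simp]:
  "param (state_of \<rho> M) = \<rho>" "input (state_of \<rho> M) = M" "index (state_of \<rho> M) = (\<lambda>_. 0)"
  "scalar (state_of \<rho> M) = (\<lambda>_. 0)" "array (state_of \<rho> M) a k = M (\<rho> WorkBase + (6 * k + slot a))"
  by (simp_all add: state_of_def)

lemma memory_state_of [simp]: "memory (state_of \<rho> M) = M"
proof
  fix c show "memory (state_of \<rho> M) c = M c"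
    using slot_nth_arrays[of "(c - \<rho> WorkBase) mod 6"] by (simp add: memory_def)
qed

lemma realizes_set_param:
  assumes "reval e s = real k" "memory s' = memory s"
    "param s' = (param s)(p := k)" "index s' = index s" "scalar s' = scalar s"
  shows "realizes (assign (Param p) (rcode e 0)) (rcost e + 2) s s'"
  using assms by (intro realizes_assign[OF computes_rcode]) (auto simp: represents_def)

lemma cost_try_vector:
  assumes P: "value_program P" and pos: "0 < \<rho> NumJobs" "0 < \<rho> NumScens"
  shows "cost \<rho> (try_vector P) \<le> 2000 * (\<rho> NumJobs ^ 2 * \<rho> NumScens)"
proof -
  define x y where "x = \<rho> NumJobs" and "y = \<rho> NumScens"
  define z where "z = x * (x * y)"
  have "cost \<rho> P \<le> 200 * (y + 1)" using P by (simp add: value_program_def y_def)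
  moreover have "cost \<rho> greedy = 43 + 135 * x + 34 * y + 148 * (x * x) + 92 * (x * y) + 64 * z"
    by (simp add: greedy_def release_jobs_def row_sums_def row_sum_def place_job_def find_job_def
        test_candidate_def remove_job_def subtract_column_def vector_at_def matrix_at_def elem_def
        address_def x_def y_def z_def algebra_simps)
  moreover have "cost \<rho> record_best + cost \<rho> next_vector \<le> 100 + 100 * x + 100 * y"
    by (simp add: record_best_def next_vector_def elem_def address_def x_def y_def algebra_simps)
  moreover obtain a b where "x = Suc a" "y = Suc b"
    using pos by (metis gr0_implies_Suc x_def y_def)
  then have "1 \<le> z" "x \<le> z" "y \<le> z" "x * x \<le> z" "x * y \<le> z"
    by (simp_all add: z_def algebra_simps)
  ultimately have "cost \<rho> (try_vector P) \<le> 2000 * z"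
    by (simp add: try_vector_def)
  then show ?thesis by (simp add: x_def y_def z_def power2_eq_square mult.assoc)
qed

lemma cost_search:
  assumes P: "value_program P" and pos: "0 < \<rho> NumJobs" "0 < \<rho> NumScens" "0 < \<rho> NumVectors"
  shows "cost \<rho> (search P) \<le> 2100 * (\<rho> NumVectors * (\<rho> NumScens * \<rho> NumJobs ^ 2))"
proof -
  let ?z = "\<rho> NumScens * \<rho> NumJobs ^ 2"
  have "cost \<rho> (try_vector P) \<le> 2000 * ?z"
    using cost_try_vector[OF P pos(1,2)] by (simp add: mult.commute)
  then have "\<rho> NumVectors * (cost \<rho> (try_vector P) + 13) + 16 \<le>
      \<rho> NumVectors * (2000 * ?z + 13) + 16"
    by (intro add_right_mono mult_left_mono) simp_all
  also have "\<dots> = 2000 * (\<rho> NumVectors * ?z) + 13 * \<rho> NumVectors + 16" by (simp add: algebra_simps)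
  also have "\<dots> \<le> 2100 * (\<rho> NumVectors * ?z)"
  proof -
    have "\<rho> NumVectors \<le> \<rho> NumVectors * ?z" "1 \<le> \<rho> NumVectors * ?z"
      using pos by (simp_all add: Suc_leI)
    then show ?thesis by linarith
  qed
  finally show ?thesis by (simp add: search_def)
qed

lemma well_formed_search: "value_program P \<Longrightarrow> well_formed (search P)"
  by (auto simp: value_program_def search_def try_vector_def greedy_def release_jobs_def row_sums_def
      row_sum_def place_job_def find_job_def test_candidate_def remove_job_def subtract_column_def
      record_best_def next_vector_def)

context encoded_instance begin

abbreviation "\<Lambda> \<equiv> layout I fmax (length ps)"
abbreviation "cells \<equiv> snd (init_store (encode ps I fmax))"

definition partially_loaded :: "param_name set \<Rightarrow> state" where
  "partially_loaded X = state_of (\<lambda>p. if p \<in> X then \<Lambda> p else 0) cells"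

primrec loads :: "param_name set \<Rightarrow> (param_name \<times> rexp) list \<Rightarrow> bool" where
  "loads X [] \<longleftrightarrow> True"
| "loads X (pe # pes) \<longleftrightarrow>
     reval (snd pe) (partially_loaded X) = real (\<Lambda> (fst pe)) \<and> loads (insert (fst pe) X) pes"

lemma cells_eq: "a < \<Lambda> WorkBase \<Longrightarrow> cells a = encode ps I fmax ! a" "\<Lambda> WorkBase \<le> a \<Longrightarrow> cells a = 0"
  by (simp_all add: init_store_def length_encode del: layout.simps)

lemma realizes_assign_params:
  "loads X pes \<Longrightarrow> realizes (assign_params pes) (sum_list (map (\<lambda>pe. rcost (snd pe) + 2) pes) + 1)
    (partially_loaded X) (partially_loaded (X \<union> fst ` set pes))"
proof (induction pes arbitrary: X)
  case Nil
  have "realizes (compile Nop) (cost \<rho> Nop) s (run Nop s)" for s :: state and \<rho>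
    using realizes_compile[of Nop s] by simp
  then show ?case by simp
next
  case (Cons pe pes)
  let ?s = "partially_loaded X" and ?s' = "partially_loaded (insert (fst pe) X)"
  have "realizes (assign (Param (fst pe)) (rcode (snd pe) 0)) (rcost (snd pe) + 2) ?s ?s'"
    by (rule realizes_set_param) (use Cons.prems in \<open>auto simp: partially_loaded_def fun_eq_iff\<close>)
  from realizes_Seq[OF this Cons.IH] show ?case using Cons.prems by (simp add: add.assoc)
qed

lemma loads_layout_params: "loads {} (layout_params (length ps))"
  using cells_eq(1)[of "length ps"] cells_eq(1)[of "length ps + 1"] cells_eq(1)[of "length ps + 2"]
    encode_nth_header[of ps I fmax] n_pos
  by (simp add: layout_params_def partially_loaded_def)

definition initial_state :: state where
  "initial_state = set_index Scenario K (state_of \<Lambda> cells)"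

lemma realizes_count_vectors:
  "realizes count_vectors (K * 22 + 13) (state_of (\<Lambda>(NumVectors := 0)) cells) initial_state"
proof -
  let ?S = "\<lambda>k. state_of (\<Lambda>(NumVectors := Suc fmax ^ k)) cells"
  have "realizes (assign (Param NumVectors) (rcode (num 1) 0)) 3
      (state_of (\<Lambda>(NumVectors := 0)) cells) (?S 0)"
    by (rule realizes_mono[OF realizes_set_param[where k = 1]]) simp_all
  moreover have "realizes (for_code Scenario NumScens (assign (Param NumVectors)
      (rcode (OfIndex (IMul (IPar NumVectors) (IAdd (IPar MaxCost) (INum 1)))) 0)))
      (K * (9 + 13) + 10) (?S 0) (set_index Scenario K (?S K))"
  proof (rule realizes_for_code)
    fix k
    let ?e = "OfIndex (IMul (IPar NumVectors) (IAdd (IPar MaxCost) (INum 1)))"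
    have "realizes (assign (Param NumVectors) (rcode ?e 0)) (rcost ?e + 2)
        (set_index Scenario k (?S k)) (set_index Scenario k (?S (Suc k)))"
      by (rule realizes_set_param[where k = "Suc fmax ^ Suc k"]) (simp_all add: algebra_simps)
    then show "realizes (assign (Param NumVectors) (rcode ?e 0)) 9
        (set_index Scenario k (?S k)) (set_index Scenario k (?S (Suc k)))" by simp
  qed simp
  ultimately have "realizes count_vectors (3 + (K * (9 + 13) + 10))
      (state_of (\<Lambda>(NumVectors := 0)) cells) (set_index Scenario K (?S K))"
    unfolding count_vectors_def by (rule realizes_Seq)
  moreover have "set_index Scenario K (?S K) = initial_state"
    by (simp add: initial_state_def fun_upd_idem)
  ultimately show ?thesis by (simp add: add.commute)
qed

lemma realizes_prologue:
  "realizes (Seq (assign_params (layout_params (length ps))) count_vectors) (100 + (K * 22 + 13))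
    (partially_loaded {}) initial_state"
proof (rule realizes_Seq)
  have "realizes (assign_params (layout_params (length ps))) 100 (partially_loaded {})
      (partially_loaded (fst ` set (layout_params (length ps))))"
    by (rule realizes_mono[OF realizes_assign_params[OF loads_layout_params, unfolded Un_empty_left]])
       (simp add: layout_params_def)
  moreover have "(\<lambda>p. if p \<in> fst ` set (layout_params (length ps)) then \<Lambda> p else 0) =
      \<Lambda>(NumVectors := 0)"
  proof
    fix p show "(if p \<in> fst ` set (layout_params (length ps)) then \<Lambda> p else 0) =
        (\<Lambda>(NumVectors := 0)) p"
      by (cases p) (simp_all add: layout_params_def)
  qed
  ultimately show "realizes (assign_params (layout_params (length ps))) 100 (partially_loaded {})
      (state_of (\<Lambda>(NumVectors := 0)) cells)"
    by (simp only: partially_loaded_def)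
qed (rule realizes_count_vectors)

lemma initial_state_simps: "loaded initial_state" "thresholds (\<lambda>_. 0) initial_state"
  using cells_eq by (simp_all add: initial_state_def loaded_def thresholds_def del: layout.simps)

definition overwrite :: "nat \<Rightarrow> state \<Rightarrow> state" where
  "overwrite k s = s\<lparr>input := \<lambda>c.
     if c < n \<and> n - k \<le> c then array s Best (n - 1 - c) else input s c\<rparr>"

lemma overwrite_sel [simp]:
  "param (overwrite k s) = param s" "index (overwrite k s) = index s"
  "scalar (overwrite k s) = scalar s" "array (overwrite k s) = array s"
  by (simp_all add: overwrite_def)

lemma overwrite_0: "overwrite 0 s = s"
proof -
  have "(\<lambda>c. if c < n \<and> n - 0 \<le> c then array s Best (n - 1 - c) else input s c) = input s" by auto
  then show ?thesis by (simp add: overwrite_def)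
qed

lemma memory_overwrite_Suc:
  assumes "k < n" "n \<le> param s WorkBase"
  shows "memory (overwrite (Suc k) s) = (memory (overwrite k s))(n - 1 - k := array s Best k)"
proof -
  have "input (overwrite (Suc k) s) = (input (overwrite k s))(n - 1 - k := array s Best k)"
    using assms(1) by (auto simp: overwrite_def fun_eq_iff)
  then have "overwrite (Suc k) s =
      (overwrite k s)\<lparr>input := (input (overwrite k s))(n - 1 - k := array s Best k)\<rparr>"
    by (simp add: overwrite_def)
  then show ?thesis using assms memory_set_input[of "n - 1 - k" "overwrite k s"] by simp
qed

lemma realizes_write_schedule:
  assumes s: "loaded s"
  shows "realizes write_schedule (n * 38 + 10) s (set_index Position n (overwrite n s))"
proof -
  let ?cell = "OfIndex (IPar NumJobs) \<ominus> OfIndex (IAdd (IVar Position) (INum 1))"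
    and ?value = "elem Best (IVar Position)"
  have N: "param s NumJobs = n" and W: "n \<le> param s WorkBase"
    using s by (simp_all add: loaded_def)
  have "realizes write_schedule (n * (25 + 13) + 10) (overwrite 0 s)
      (set_index Position n (overwrite n s))"
    unfolding write_schedule_def
  proof (rule realizes_for_code)
    fix k assume k: "k < n"
    let ?s = "set_index Position k (overwrite k s)"
      and ?s' = "set_index Position k (overwrite (Suc k) s)"
    have "computes (rcode ?cell 0) (rcost ?cell) 0 ?s (real (n - 1 - k))"
      using computes_rcode[of ?cell 0 ?s] k N by (simp add: of_nat_diff)
    then have "realizes (store_code (rcode ?cell 0) (rcode ?value 1))
        (rcost ?cell + rcost ?value + 1) ?s ?s'"
      using k W by (intro realizes_store[OF _ computes_rcode]) (simp_all add: memory_overwrite_Suc)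
    then show "realizes (store_code (rcode ?cell 0) (rcode ?value 1)) 25 ?s ?s'"
      by (rule realizes_mono) (simp add: elem_def address_def)
  qed (simp add: N)
  then show ?thesis by (simp add: overwrite_0)
qed

lemma realizes_search:
  assumes "value_program P"
  shows "realizes (compile (search P)) (2100 * (Suc fmax ^ K * (K * n ^ 2)))
    initial_state (run (search P) initial_state)"
proof (rule realizes_mono[OF realizes_compile[OF well_formed_search[OF assms]]])
  show "cost (param initial_state) (search P) \<le> 2100 * (Suc fmax ^ K * (K * n ^ 2))"
    using cost_search[OF assms, of "param initial_state"] loaded_sizes[OF initial_state_simps(1)]
      n_pos K_pos by simp
qed

lemma exec_solver:
  assumes "value_program P"
  shows "\<exists>t R M. exec (solver (length ps) P) (init_store (encode ps I fmax)) t (R, M) \<and>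
    t \<le> 3000 * (Suc fmax ^ K * (K * n ^ 2)) \<and>
    (\<forall>k<n. M k = array (run (search P) initial_state) Best (n - 1 - k))"
proof -
  let ?s = "run (search P) initial_state" and ?z = "Suc fmax ^ K * (K * n ^ 2)"
  let ?s' = "set_index Position n (overwrite n ?s)"
  have loaded: "loaded ?s" using initial_state_simps(1) by simp
  have "realizes (solver (length ps) P) (100 + (K * 22 + 13) + (2100 * ?z + (n * 38 + 10)))
      (partially_loaded {}) ?s'"
    unfolding solver_def
    by (intro realizes_Seq[OF realizes_prologue] realizes_Seq[OF realizes_search[OF assms]]
        realizes_write_schedule[OF loaded])
  moreover have "represents (partially_loaded {}) (\<lambda>_. 0)"
    by (simp add: partially_loaded_def represents_def)
  ultimately obtain t R where
    exec: "exec (solver (length ps) P) (\<lambda>_. 0, memory (partially_loaded {})) t (R, memory ?s')"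
      "t \<le> 100 + (K * 22 + 13) + (2100 * ?z + (n * 38 + 10))"
    by (rule realizesE)
  have "exec (solver (length ps) P) (init_store (encode ps I fmax)) t (R, memory ?s')"
    using exec(1) by (simp add: partially_loaded_def init_store_def)
  moreover have "1 \<le> ?z" "K \<le> ?z" "n \<le> ?z"
    using n_pos K_pos by (simp_all add: Suc_leI power2_eq_square)
  then have "t \<le> 3000 * ?z" using exec(2) by linarith
  moreover have "\<forall>k<n. memory ?s' k = array ?s Best (n - 1 - k)"
    using loaded by (simp add: memory_input overwrite_def loaded_def)
  ultimately show ?thesis by blast
qed

lemma solver_correct:
  assumes P: "value_program P" "evaluates P val" and exact: "exact_value obj val"
  shows "solves_within obj ps (solver (length ps) P) I fmax
    (3000 * (real (fmax + 1) ^ K * (real K * real n ^ 2)))"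
proof -
  obtain \<pi> where \<pi>: "is_arg_min (obj I) (schedule I) \<pi>"
    "\<forall>p<n. array (run (search P) initial_state) Best p = real (rev \<pi> ! p)"
    using optimal_if_best_upto[OF exact best_upto_search[OF P initial_state_simps]] by blast
  obtain t R M where exec: "exec (solver (length ps) P) (init_store (encode ps I fmax)) t (R, M)"
    "t \<le> 3000 * (Suc fmax ^ K * (K * n ^ 2))"
    "\<forall>k<n. M k = array (run (search P) initial_state) Best (n - 1 - k)"
    using exec_solver[OF P(1)] by blast
  have "length \<pi> = n"
    using \<pi>(1) length_if_set_eq by (auto simp: is_arg_min_def schedule_iff)
  then have "\<forall>k<n. M k = real (\<pi> ! k)" using exec(3) \<pi>(2) by (simp add: rev_nth)
  moreover have "real t \<le> 3000 * (real (fmax + 1) ^ K * (real K * real n ^ 2))"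
    using of_nat_mono[OF exec(2), where ?'a = real]
    by (simp only: of_nat_mult of_nat_power of_nat_numeral Suc_eq_plus1)
  ultimately show ?thesis
    unfolding solves_within_def using exec(1) \<pi>(1) by blast
qed

lemma denotes_parameter: "ps \<noteq> [] \<Longrightarrow> denotes (Cell (INum 0)) (ps ! 0)"
  using encode_nth_param[of 0 ps I fmax] by (simp add: denotes_def loaded_def memory_input)

end

lemma solvable_in_O_if_exact:
  assumes P: "value_program P"
    and val: "\<And>I fmax. valid_instance I \<Longrightarrow> cost_bound I fmax \<Longrightarrow>
      encoded_instance.evaluates I fmax ps P (val I fmax) \<and>
      bounded_instance.exact_value I fmax obj (val I fmax)"
  shows "solvable_in_O obj ps (\<lambda>n K fmax. real fmax ^ K * (real K * real n ^ 2))"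
proof -
  have solves: "solves_within obj ps (solver (length ps) P) I fmax
      (3000 * (real (fmax + 1) ^ nscens I * (real (nscens I) * real (njobs I) ^ 2)))"
    if "valid_instance I" "cost_bound I fmax" for I fmax
  proof -
    interpret encoded_instance I fmax ps using that by unfold_locales
    show ?thesis using solver_correct[OF P] val[OF that] by blast
  qed
  have "solves_within obj ps (solver (length ps) P) I fmax
      (3000 * 2 ^ K * (real fmax ^ K * (real K * real (njobs I) ^ 2)))"
    if "valid_instance I" "nscens I = K" "cost_bound I fmax" "fmax \<ge> 1" for I fmax K
  proof -
    have "real (fmax + 1) ^ K \<le> (2 * real fmax) ^ K" using that(4) by (intro power_mono) auto
    then have "3000 * (real (fmax + 1) ^ K * (real K * real (njobs I) ^ 2)) \<le>
        3000 * ((2 * real fmax) ^ K * (real K * real (njobs I) ^ 2))"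
      by (intro mult_left_mono mult_right_mono) auto
    also have "\<dots> = 3000 * 2 ^ K * (real fmax ^ K * (real K * real (njobs I) ^ 2))"
      by (simp add: power_mult_distrib)
    finally show ?thesis
      using solves[OF that(1,3)] that(2) unfolding solves_within_def by (meson order_trans)
  qed
  with solves show ?thesis unfolding solvable_in_O_def by blast
qed

lemma solvable_Exp: "solvable_in_O Exp_cost [] (\<lambda>n K fmax. real fmax ^ K * (real K * real n ^ 2))"
proof (rule solvable_in_O_if_exact)
  show "value_program (CVaR_program (num 0))" by (rule value_program_CVaR_VaR) simp
  fix I fmax assume "valid_instance I" "cost_bound I fmax"
  then interpret encoded_instance I fmax "[]" by unfold_locales
  show "evaluates (CVaR_program (num 0)) (CVaR_value 0) \<and> exact_value Exp_cost (CVaR_value 0)"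
    by (simp add: evaluates_CVaR_program exact_value_Exp denotes_def)
qed

lemma solvable_CVaR:
  assumes "\<alpha> \<in> {0..<1}"
  shows "solvable_in_O (CVaR_cost \<alpha>) [\<alpha>] (\<lambda>n K fmax. real fmax ^ K * (real K * real n ^ 2))"
proof (rule solvable_in_O_if_exact)
  show "value_program (CVaR_program (Cell (INum 0)))" by (rule value_program_CVaR_VaR) simp
  fix I fmax assume "valid_instance I" "cost_bound I fmax"
  then interpret encoded_instance I fmax "[\<alpha>]" by unfold_locales
  show "evaluates (CVaR_program (Cell (INum 0))) (CVaR_value \<alpha>) \<and>
      exact_value (CVaR_cost \<alpha>) (CVaR_value \<alpha>)"
    using assms denotes_parameter by (simp add: evaluates_CVaR_program exact_value_CVaR)
qed

lemma solvable_VaR: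
  assumes "\<alpha> \<in> {0<..1}"
  shows "solvable_in_O (VaR_cost \<alpha>) [\<alpha>] (\<lambda>n K fmax. real fmax ^ K * (real K * real n ^ 2))"
proof (rule solvable_in_O_if_exact)
  show "value_program (VaR_program (Cell (INum 0)))" by (rule value_program_CVaR_VaR) simp
  fix I fmax assume "valid_instance I" "cost_bound I fmax"
  then interpret encoded_instance I fmax "[\<alpha>]" by unfold_locales
  show "evaluates (VaR_program (Cell (INum 0))) (VaR_value \<alpha>) \<and>
      exact_value (VaR_cost \<alpha>) (VaR_value \<alpha>)"
    using assms denotes_parameter by (simp add: evaluates_VaR_program exact_value_VaR)
qed

theorem theorem15:
  shows "solvable_in_O Exp_cost [] (\<lambda>n K fmax. real fmax ^ K * (real K * real n ^ 2)) \<and>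
    (\<forall>\<alpha>\<in>{0<..1}. solvable_in_O (VaR_cost \<alpha>) [\<alpha>]
       (\<lambda>n K fmax. real fmax ^ K * (real K * real n ^ 2))) \<and>
    (\<forall>\<alpha>\<in>{0..<1}. solvable_in_O (CVaR_cost \<alpha>) [\<alpha>]
       (\<lambda>n K fmax. real fmax ^ K * (real K * real n ^ 2)))"
  using solvable_Exp solvable_VaR solvable_CVaR by blast

end
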